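(* Let $R$ be a commutative Noetherian ring with non-zero identity, $I$ an ideal of $R$, and $E$ a non-zero finitely generated $R$-module. Then each of the two sequences of sets of associated primes $$\operatorname{Ass}_R\bigl(E/\widetilde{I^n_E}\bigr)\quad\text{and}\quad \operatorname{Ass}_R\bigl(\widetilde{I^n_E}/\widetilde{I^{n+1}_E}\bigr),\qquad n=1,2,\dots,$$ is increasing (with respect to inclusion, as $n$ increases) and eventually constant.
   Context: For an ideal $J$ of a commutative ring $R$ and an $R$-module $E$, the Ratliff-Rush closure of $J$ with respect to $E$ is the submodule $$\widetilde{J_E}=\bigcup_{k\in\mathbb{N}}(J^{k+1}E:_E J^k)=\{e\in E : J^k e\subseteq J^{k+1}E\text{ for some }k\in\mathbb{N}\}$$ of $E$. For $n\ge 1$, $\widetilde{I^n_E}$ denotes the Ratliff-Rush closure of the ideal $I^n$ with respect to $E$, i.e. $\widetilde{J_E}$ with $J=I^n$. *)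

theory Defs
  imports "HOL-Algebra.Module" "HOL-Algebra.Ideal_Product" "HOL-Algebra.Ring_Divisibility"
begin

text \<open>Powers of an ideal are powers in the library semiring \<^const>\<open>ideals_set\<close>, whose unit is the
  unit ideal, so the zeroth power of an ideal is the whole ring.\<close>

abbreviation ideal_pow :: "('a, 'r) ring_scheme \<Rightarrow> 'a set \<Rightarrow> nat \<Rightarrow> 'a set"
  where "ideal_pow R J k \<equiv> J [^]\<^bsub>ideals_set R\<^esub> k"

definition submodule_span ::
    "('a, 'r) ring_scheme \<Rightarrow> ('a, 'e, 'm) module_scheme \<Rightarrow> 'e set \<Rightarrow> 'e set"
  where "submodule_span R M S = \<Inter>{N. submodule N R M \<and> S \<subseteq> N}"

definition finitely_generated_module ::
    "('a, 'r) ring_scheme \<Rightarrow> ('a, 'e, 'm) module_scheme \<Rightarrow> bool"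
  where "finitely_generated_module R M \<longleftrightarrow>
    (\<exists>S. finite S \<and> S \<subseteq> carrier M \<and> submodule_span R M S = carrier M)"

definition ideal_smult ::
    "('a, 'r) ring_scheme \<Rightarrow> ('a, 'e, 'm) module_scheme \<Rightarrow> 'a set \<Rightarrow> 'e set \<Rightarrow> 'e set"
  where "ideal_smult R M J N = submodule_span R M {a \<odot>\<^bsub>M\<^esub> x | a x. a \<in> J \<and> x \<in> N}"

definition module_colon :: "('a, 'e, 'm) module_scheme \<Rightarrow> 'e set \<Rightarrow> 'a set \<Rightarrow> 'e set"
  where "module_colon M N J = {e \<in> carrier M. \<forall>a\<in>J. a \<odot>\<^bsub>M\<^esub> e \<in> N}"

definition ratliff_rush ::
    "('a, 'r) ring_scheme \<Rightarrow> ('a, 'e, 'm) module_scheme \<Rightarrow> 'a set \<Rightarrow> 'e set"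
  where "ratliff_rush R M J =
    (\<Union>k. module_colon M (ideal_smult R M (ideal_pow R J (k + 1)) (carrier M)) (ideal_pow R J k))"

abbreviation rr_power ::
    "('a, 'r) ring_scheme \<Rightarrow> ('a, 'e, 'm) module_scheme \<Rightarrow> 'a set \<Rightarrow> nat \<Rightarrow> 'e set"
  where "rr_power R M J n \<equiv> ratliff_rush R M (ideal_pow R J n)"

text \<open>The quotient module on the additive cosets of \<open>N\<close>. The scalar action sends \<open>N + x\<close> to
  \<open>N + a x\<close>, written as a union over all representatives, which all give the same coset when \<open>N\<close> is a
  submodule. The library's module record also has the multiplicative fields of a ring; they play
  no role in a module and are left undefined.\<close>

definition quotient_module :: "('a, 'e, 'm) module_scheme \<Rightarrow> 'e set \<Rightarrow> ('a, 'e set) module"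
  where "quotient_module M N =
    \<lparr> carrier = a_rcosets\<^bsub>M\<^esub> N, monoid.mult = undefined, one = undefined,
      zero = N, add = (<+>\<^bsub>M\<^esub>), smult = (\<lambda>a C. \<Union>x\<in>C. N +>\<^bsub>M\<^esub> (a \<odot>\<^bsub>M\<^esub> x)) \<rparr>"

definition annihilator ::
    "('a, 'r) ring_scheme \<Rightarrow> ('a, 'e, 'm) module_scheme \<Rightarrow> 'e \<Rightarrow> 'a set"
  where "annihilator R M x = {a \<in> carrier R. a \<odot>\<^bsub>M\<^esub> x = \<zero>\<^bsub>M\<^esub>}"

definition Ass :: "('a, 'r) ring_scheme \<Rightarrow> ('a, 'e, 'm) module_scheme \<Rightarrow> 'a set set"
  where "Ass R M = {P. primeideal P R \<and> (\<exists>x\<in>carrier M. P = annihilator R M x)}"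

lemma (in module) quotient_module_smult_coset:
  assumes N: "submodule N R M" and a: "a \<in> carrier R" and x: "x \<in> carrier M"
  shows "a \<odot>\<^bsub>quotient_module M N\<^esub> (N +>\<^bsub>M\<^esub> x) = N +>\<^bsub>M\<^esub> (a \<odot>\<^bsub>M\<^esub> x)"
proof -
  interpret N: submodule N R M by (rule N)
  have eq: "N +>\<^bsub>M\<^esub> (a \<odot>\<^bsub>M\<^esub> y) = N +>\<^bsub>M\<^esub> (a \<odot>\<^bsub>M\<^esub> x)" if y: "y \<in> N +>\<^bsub>M\<^esub> x" for y
  proof -
    from y obtain n where n: "n \<in> N" "y = n \<oplus>\<^bsub>M\<^esub> x"
      by (auto simp: a_r_coset_def')
    have nM: "n \<in> carrier M" using n(1) N.subset by auto
    have "a \<odot>\<^bsub>M\<^esub> y = a \<odot>\<^bsub>M\<^esub> n \<oplus>\<^bsub>M\<^esub> a \<odot>\<^bsub>M\<^esub> x"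
      using n nM a x by (simp add: smult_r_distr)
    moreover have "a \<odot>\<^bsub>M\<^esub> n \<in> N" using N.smult_closed a n by simp
    ultimately have "a \<odot>\<^bsub>M\<^esub> y \<in> N +>\<^bsub>M\<^esub> (a \<odot>\<^bsub>M\<^esub> x)"
      by (auto simp: a_r_coset_def')
    then show ?thesis
      using M.a_repr_independence[OF _ _ N.subgroup_axioms] a x by (metis smult_closed)
  qed
  have "\<zero>\<^bsub>M\<^esub> \<oplus>\<^bsub>M\<^esub> x \<in> N +>\<^bsub>M\<^esub> x"
    unfolding a_r_coset_def' using N.one_closed by (simp only: monoid.simps) blast
  then have "x \<in> N +>\<^bsub>M\<^esub> x" using x by simp
  then have "(\<Union>y\<in>N +>\<^bsub>M\<^esub> x. N +>\<^bsub>M\<^esub> (a \<odot>\<^bsub>M\<^esub> y)) = N +>\<^bsub>M\<^esub> (a \<odot>\<^bsub>M\<^esub> x)"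
    using eq by blast
  then show ?thesis by (simp add: quotient_module_def)
qed

lemma (in module) quotient_module_is_module:
  assumes N: "submodule N R M"
  shows "module R (quotient_module M N)"
proof -
  interpret N: submodule N R M by (rule N)
  interpret A: abelian_subgroup N M
    by (rule abelian_subgroupI3)
       (simp_all add: additive_subgroup_def N.subgroup_axioms M.abelian_group_axioms)
  let ?Q = "quotient_module M N"
  have carr: "carrier ?Q = a_rcosets\<^bsub>M\<^esub> N" and addQ: "add ?Q = (<+>\<^bsub>M\<^esub>)"
    and zQ: "zero ?Q = N"
    by (simp_all add: quotient_module_def)
  have coset: "\<exists>x\<in>carrier M. C = N +>\<^bsub>M\<^esub> x" if "C \<in> carrier ?Q" for C
    using that by (auto simp: carr A_RCOSETS_def')
  have in_carr: "N +>\<^bsub>M\<^esub> x \<in> carrier ?Q" if "x \<in> carrier M" for x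
    using that by (auto simp: carr A_RCOSETS_def')
  have sum: "(N +>\<^bsub>M\<^esub> x) \<oplus>\<^bsub>?Q\<^esub> (N +>\<^bsub>M\<^esub> y) = N +>\<^bsub>M\<^esub> (x \<oplus>\<^bsub>M\<^esub> y)"
    if "x \<in> carrier M" "y \<in> carrier M" for x y
    using A.a_rcos_sum[OF that] by (simp add: addQ)
  have N_coset: "N +>\<^bsub>M\<^esub> \<zero>\<^bsub>M\<^esub> = N"
    using M.a_coset_add_zero[OF N.subset[simplified]] by simp
  have ab: "abelian_group ?Q"
  proof (rule abelian_groupI, goal_cases)
    case (1 C D) then show ?case using coset[of C] coset[of D] in_carr by (auto simp: sum)
  next
    case 2 then show ?case using in_carr[of "\<zero>\<^bsub>M\<^esub>"] N_coset by (simp add: zQ)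
  next
    case (3 C D F) then show ?case
      using coset[of C] coset[of D] coset[of F] by (auto simp: sum M.a_assoc)
  next
    case (4 C D) then show ?case using coset[of C] coset[of D] by (auto simp: sum M.a_comm)
  next
    case (5 C)
    then obtain x where "x \<in> carrier M" "C = N +>\<^bsub>M\<^esub> x" using coset by blast
    then show ?case using sum[of "\<zero>\<^bsub>M\<^esub>" x] N_coset by (simp add: zQ)
  next
    case (6 C)
    then obtain x where x: "x \<in> carrier M" "C = N +>\<^bsub>M\<^esub> x" using coset by blast
    then show ?case
      using sum[of "\<ominus>\<^bsub>M\<^esub> x" x] in_carr[of "\<ominus>\<^bsub>M\<^esub> x"] N_coset
      by (auto simp: zQ M.l_neg)
  qed
  note smult = quotient_module_smult_coset[OF N]
  show ?thesis
  proof (rule moduleI[OF R.cring_axioms ab], goal_cases)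
    case (1 a C) then show ?case using coset[of C] in_carr by (auto simp: smult)
  next
    case (2 a b C) then show ?case using coset[of C] by (auto simp: smult sum smult_l_distr)
  next
    case (3 a C D) then show ?case using coset[of C] coset[of D] by (auto simp: smult sum smult_r_distr)
  next
    case (4 a b C) then show ?case using coset[of C] by (auto simp: smult smult_assoc1)
  next
    case (5 C) then show ?case using coset[of C] by (auto simp: smult)
  qed
qed

end

theory Submission
  imports Defs
begin

text \<open>Write \<open>F\<^sub>n = \<Union>m. (I\<^sup>n\<^sup>+\<^sup>m E : I\<^sup>m)\<close>; for \<open>n \<ge> 1\<close> this is the Ratliff-Rush closure of \<open>I\<^sup>n\<close> with
  respect to \<open>E\<close>. Associated primes of \<open>E / F\<^sub>n\<close> are prime ideals of the form \<open>(F\<^sub>n : e)\<close>.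

  Both sequences increase because \<open>(F\<^sub>n\<^sub>+\<^sub>1 : I) = F\<^sub>n\<close> (\<open>rr_filtration_smult\<close> and
  \<open>rr_filtration_colon\<close>). If \<open>I\<close> is generated by \<open>a\<^sub>1, \<dots>, a\<^sub>r\<close>, then
  \<open>(F\<^sub>n : e) = \<Inter>i. (F\<^sub>n\<^sub>+\<^sub>1 : a\<^sub>i e)\<close>; when the left side is prime it equals one of the ideals on the right,
  so \<open>a\<^sub>i e\<close> is a witness for the same prime one level higher (\<open>associated_prime_shift\<close>).

  An increasing sequence of subsets of a finite set is eventually constant, so it remains to find a
  finite set containing all these primes. Every associated prime of \<open>E / F\<^sub>n\<close> is associated to some
  \<open>F\<^sub>k / F\<^sub>k\<^sub>+\<^sub>1\<close> with \<open>k < n\<close> (\<open>ass_total_subset_steps\<close>). A witness \<open>e \<in> F\<^sub>k\<close> for the latter satisfies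
  \<open>I\<^sup>m e \<subseteq> I\<^sup>k\<^sup>+\<^sup>m E\<close> for some \<open>m\<close>, so after \<open>m\<close> shifts the witness lies in \<open>I\<^sup>k\<^sup>+\<^sup>m E\<close>. Hence all primes in
  question are associated to one graded module, \<open>\<Oplus>n. I\<^sup>n E / (I\<^sup>n E \<inter> F\<^sub>n\<^sub>+\<^sub>1)\<close>, over the Rees ring of
  \<open>I\<close>. It is Noetherian, so it has finitely many associated primes
  (\<open>finite_graded_associated_primes\<close>).

  The Noetherian property is the graded Hilbert basis theorem (\<open>acc_graded_submodules_rees\<close>). Graded
  modules are represented as sequences of submodules of \<open>E\<close>, so that no polynomial ring, Rees ring or
  direct sum occurs. The induction removes one generator \<open>a\<close> of \<open>I\<close> at a time, by passing to the
  coefficients of the lowest power of \<open>a\<close>.\<close>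

section \<open>The ascending chain condition\<close>

text \<open>The order is arbitrary because the condition is needed for ideals, for submodules and, pointwise,
  for sequences of submodules.\<close>

definition acc_on :: "('x::order) set \<Rightarrow> bool"
  where "acc_on A \<longleftrightarrow> (\<forall>f::nat \<Rightarrow> 'x. (\<forall>k. f k \<in> A \<and> f k \<le> f (Suc k)) \<longrightarrow> (\<exists>k0. \<forall>k\<ge>k0. f k = f k0))"

lemma acc_onD:
  assumes "acc_on A" "\<And>k. f k \<in> A" "\<And>k. f k \<le> f (Suc k)"
  obtains k0 :: nat where "\<And>k. k \<ge> k0 \<Longrightarrow> f k = f k0"
  using assms unfolding acc_on_def by blast

lemma acc_on_maximal:
  assumes acc: "acc_on A" and X: "X \<subseteq> A" "x \<in> X"
  obtains m where "m \<in> X" "\<And>y. y \<in> X \<Longrightarrow> m \<le> y \<Longrightarrow> y = m"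
proof -
  have "\<exists>m\<in>X. \<forall>y\<in>X. m \<le> y \<longrightarrow> y = m"
  proof (rule ccontr)
    assume "\<not> ?thesis"
    then have step: "\<exists>y. y \<in> X \<and> m < y" if "m \<in> X" for m
      using that by (metis order_le_less)
    obtain f where f: "\<And>n. f n \<in> X" "\<And>n. f n < f (Suc n)"
      using dependent_nat_choice[of "\<lambda>_ m. m \<in> X" "\<lambda>_ m y. m < y"] X step by metis
    obtain k0 where "\<And>k. k \<ge> k0 \<Longrightarrow> f k = f k0"
      using acc_onD[OF acc, of f] f X by (metis less_imp_le subsetD)
    then show False using f(2)[of k0] by (metis le_Suc_eq order_refl less_irrefl)
  qed
  then show ?thesis using that by blast
qed

text \<open>A family that is monotone in both indices stabilises in one index uniformly in the other: the
  diagonal becomes constant at some \<open>s\<close>, which settles every row \<open>d \<ge> s\<close> from column \<open>s\<close> on, and the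
  finitely many rows \<open>d < s\<close> stabilise one by one.\<close>

lemma acc_on_doubly_indexed:
  fixes f :: "nat \<Rightarrow> nat \<Rightarrow> 'x::order"
  assumes acc: "acc_on A" and A: "\<And>d k. f d k \<in> A"
    and mono1: "\<And>d k. f d k \<le> f (Suc d) k" and mono2: "\<And>d k. f d k \<le> f d (Suc k)"
  obtains k0 where "\<And>d k. k \<ge> k0 \<Longrightarrow> f d k = f d k0"
proof -
  have le1: "f d k \<le> f d' k" if "d \<le> d'" for d d' k
    using lift_Suc_mono_le[of "\<lambda>d. f d k"] mono1 that by blast
  have le2: "f d k \<le> f d k'" if "k \<le> k'" for d k k'
    using lift_Suc_mono_le[of "f d"] mono2 that by blast
  obtain s where s: "\<And>k. k \<ge> s \<Longrightarrow> f k k = f s s"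
    using acc_onD[OF acc, of "\<lambda>k. f k k"] A by (metis mono1 mono2 order_trans)
  have big: "f d k = f s s" if "d \<ge> s" "k \<ge> s" for d k
  proof (rule antisym)
    have "f d k \<le> f (max d k) k" by (rule le1) simp
    also have "\<dots> \<le> f (max d k) (max d k)" by (rule le2) simp
    finally have "f d k \<le> f (max d k) (max d k)" .
    then show "f d k \<le> f s s" using s[of "max d k"] that by (simp add: max.coboundedI1)
    show "f s s \<le> f d k" using le1[OF that(1), of s] le2[OF that(2), of d] by (rule order_trans)
  qed
  have "\<exists>k0. \<forall>k\<ge>k0. f d k = f d k0" for d
    using acc_onD[OF acc, of "f d"] A mono2 by metis
  then obtain g where g: "\<And>d k. k \<ge> g d \<Longrightarrow> f d k = f d (g d)" by metis
  define k0 where "k0 = max s (Max (g ` {..s}))"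
  have "f d k = f d k0" if "k \<ge> k0" for d k
  proof (cases "d \<le> s")
    case True
    then have "g d \<le> k0" unfolding k0_def by (simp add: le_max_iff_disj)
    then show ?thesis using g[of d k] g[of d k0] that by simp
  next
    case False
    then show ?thesis using big[of d k] big[of d k0] that unfolding k0_def by simp
  qed
  then show ?thesis using that by blast
qed

lemma acc_on_subset: "acc_on B \<Longrightarrow> A \<subseteq> B \<Longrightarrow> acc_on A"
  unfolding acc_on_def by blast

text \<open>This is the skeleton of the Hilbert basis theorem: \<open>\<phi> d x\<close> is the module of coefficients of
  degree \<open>d\<close> of \<open>x\<close>, which grows with \<open>d\<close> and with \<open>x\<close>, and comparable objects with the same
  coefficient modules coincide.\<close>

lemma acc_on_refine:
  fixes \<phi> :: "nat \<Rightarrow> 'x::order \<Rightarrow> 'y::order"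
  assumes acc: "acc_on B" and maps: "\<And>d x. x \<in> A \<Longrightarrow> \<phi> d x \<in> B"
    and mono1: "\<And>d x. x \<in> A \<Longrightarrow> \<phi> d x \<le> \<phi> (Suc d) x"
    and mono2: "\<And>d x y. x \<in> A \<Longrightarrow> y \<in> A \<Longrightarrow> x \<le> y \<Longrightarrow> \<phi> d x \<le> \<phi> d y"
    and inj: "\<And>x y. x \<in> A \<Longrightarrow> y \<in> A \<Longrightarrow> x \<le> y \<Longrightarrow> (\<And>d. \<phi> d y = \<phi> d x) \<Longrightarrow> y \<le> x"
  shows "acc_on A"
  unfolding acc_on_def
proof (intro allI impI)
  fix f :: "nat \<Rightarrow> 'x"
  assume f: "\<forall>k. f k \<in> A \<and> f k \<le> f (Suc k)"
  obtain k0 where k0: "\<And>d k. k \<ge> k0 \<Longrightarrow> \<phi> d (f k) = \<phi> d (f k0)"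
    using acc_on_doubly_indexed[OF acc, of "\<lambda>d k. \<phi> d (f k)"] maps mono1 mono2 f by metis
  have "f k = f k0" if "k \<ge> k0" for k
  proof (rule antisym)
    show le: "f k0 \<le> f k" using lift_Suc_mono_le[of f] f that by blast
    show "f k \<le> f k0" using inj[OF _ _ le] f k0 that by blast
  qed
  then show "\<exists>k0. \<forall>k\<ge>k0. f k = f k0" by blast
qed

lemma (in noetherian_ring) acc_ideals: "acc_on {J. ideal J R}"
  unfolding acc_on_def
proof (intro allI impI)
  fix f :: "nat \<Rightarrow> 'a set"
  assume f: "\<forall>k. f k \<in> {J. ideal J R} \<and> f k \<le> f (Suc k)"
  have le: "f i \<subseteq> f j" if "i \<le> j" for i j using lift_Suc_mono_le[of f] f that by blast
  have "\<Union>(range f) \<in> range f"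
    by (rule ideal_chain_is_trivial) (use f le in \<open>auto simp: subset_chain_def, metis le_cases subsetD\<close>)
  then obtain k0 where "\<Union>(range f) = f k0" by blast
  then show "\<exists>k0. \<forall>k\<ge>k0. f k = f k0" using le by (metis UN_upper UNIV_I subset_antisym)
qed

lemma set_addI: "u \<in> A \<Longrightarrow> v \<in> B \<Longrightarrow> u \<oplus>\<^bsub>G\<^esub> v \<in> A <+>\<^bsub>G\<^esub> B"
  unfolding set_add_def' by blast

context module begin

lemma submodule_sum:
  assumes "submodule A R M" "submodule B R M"
  shows "submodule (A <+>\<^bsub>M\<^esub> B) R M"
proof -
  note A = submoduleE[OF assms(1)] and B = submoduleE[OF assms(2)]
  have z: "\<zero>\<^bsub>M\<^esub> \<in> A" "\<zero>\<^bsub>M\<^esub> \<in> B"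
    using assms subgroup.one_closed[OF submodule.axioms(1)] by fastforce+
  have c: "x \<in> carrier M" if "x \<in> A \<or> x \<in> B" for x using A(1) B(1) that by blast
  show ?thesis
  proof (rule submoduleI, goal_cases)
    case 1 then show ?case using c by (auto simp: set_add_def')
  next
    case 2 then show ?case using z by (force simp: set_add_def')
  next
    case (3 x)
    then obtain u v where uv: "u \<in> A" "v \<in> B" "x = u \<oplus>\<^bsub>M\<^esub> v" by (auto simp: set_add_def')
    then have "\<ominus>\<^bsub>M\<^esub> x = \<ominus>\<^bsub>M\<^esub> u \<oplus>\<^bsub>M\<^esub> \<ominus>\<^bsub>M\<^esub> v" using c by (simp add: M.minus_add)
    then show ?case using uv A(3) B(3) by (auto simp: set_add_def')
  next
    case (4 x y)
    then obtain u v u' v' where uv: "u \<in> A" "v \<in> B" "x = u \<oplus>\<^bsub>M\<^esub> v" "u' \<in> A" "v' \<in> B" "y = u' \<oplus>\<^bsub>M\<^esub> v'"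
      by (auto simp: set_add_def')
    have "x \<oplus>\<^bsub>M\<^esub> y = (u \<oplus>\<^bsub>M\<^esub> u') \<oplus>\<^bsub>M\<^esub> (v \<oplus>\<^bsub>M\<^esub> v')"
      using uv c by (simp add: M.a_ac)
    also have "\<dots> \<in> A <+>\<^bsub>M\<^esub> B" using uv A(5) B(5) by (intro set_addI) auto
    finally show ?case .
  next
    case (5 a x)
    then obtain u v where uv: "u \<in> A" "v \<in> B" "x = u \<oplus>\<^bsub>M\<^esub> v" by (auto simp: set_add_def')
    then have "a \<odot>\<^bsub>M\<^esub> x = a \<odot>\<^bsub>M\<^esub> u \<oplus>\<^bsub>M\<^esub> a \<odot>\<^bsub>M\<^esub> v" using c 5 by (simp add: smult_r_distr)
    also have "\<dots> \<in> A <+>\<^bsub>M\<^esub> B" using uv A(4) B(4) 5 by (intro set_addI) auto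
    finally show ?case .
  qed
qed

lemma submodule_zero_mem: "submodule N R M \<Longrightarrow> \<zero>\<^bsub>M\<^esub> \<in> N"
  using subgroup.one_closed[OF submodule.axioms(1)] by fastforce

lemma submodule_minus_closed:
  "\<lbrakk>submodule N R M; x \<in> N; y \<in> N\<rbrakk> \<Longrightarrow> x \<ominus>\<^bsub>M\<^esub> y \<in> N"
  by (simp add: submoduleE a_minus_def)

lemma submodule_smult_image:
  assumes a: "a \<in> carrier R" and N: "submodule N R M"
  shows "submodule ((\<lambda>x. a \<odot>\<^bsub>M\<^esub> x) ` N) R M"
proof -
  note N' = submoduleE[OF N]
  have c: "x \<in> carrier M" if "x \<in> N" for x using N'(1) that by blast
  show ?thesis
  proof (rule submoduleI, goal_cases)
    case 1 then show ?case using a c by auto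
  next
    case 2 then show ?case using a submodule_zero_mem[OF N] by (metis image_eqI smult_r_null)
  next
    case (3 x) then show ?case using a c N' by (auto simp: smult_r_minus[symmetric])
  next
    case (4 x y) then show ?case using a c N' by (auto simp: smult_r_distr[symmetric])
  next
    case (5 b x)
    have "b \<odot>\<^bsub>M\<^esub> (a \<odot>\<^bsub>M\<^esub> y) = a \<odot>\<^bsub>M\<^esub> (b \<odot>\<^bsub>M\<^esub> y)" if "y \<in> N" for y
      using 5 a c that by (metis smult_assoc1 R.m_comm)
    then show ?case using 5 a N' by auto
  qed
qed

lemma submodule_span_submodule:
  assumes "S \<subseteq> carrier M"
  shows "submodule (submodule_span R M S) R M"
proof (rule submoduleI, goal_cases)
  case 1 then show ?case unfolding submodule_span_def using assms carrier_is_submodule by blast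
qed (auto simp: submodule_span_def submodule_zero_mem submoduleE)

lemma submodule_span_superset: "S \<subseteq> submodule_span R M S"
  unfolding submodule_span_def by blast

lemma submodule_span_minimal: "submodule N R M \<Longrightarrow> S \<subseteq> N \<Longrightarrow> submodule_span R M S \<subseteq> N"
  unfolding submodule_span_def by blast

lemma submodule_cyclic:
  assumes x: "x \<in> carrier M"
  shows "submodule ((\<lambda>r. r \<odot>\<^bsub>M\<^esub> x) ` carrier R) R M"
  by (rule submoduleI)
    (use x in \<open>auto simp: smult_l_minus[symmetric] smult_l_distr[symmetric] smult_assoc1[symmetric]
      intro: image_eqI[of _ _ \<zero>]\<close>)

lemma submodule_span_insert:
  assumes "x \<in> carrier M" "S \<subseteq> carrier M"
  shows "submodule_span R M (insert x S)
    \<subseteq> (\<lambda>r. r \<odot>\<^bsub>M\<^esub> x) ` carrier R <+>\<^bsub>M\<^esub> submodule_span R M S"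
proof (rule submodule_span_minimal)
  note sp = submodule_span_submodule[OF assms(2)] and cy = submodule_cyclic[OF assms(1)]
  show "submodule ((\<lambda>r. r \<odot>\<^bsub>M\<^esub> x) ` carrier R <+>\<^bsub>M\<^esub> submodule_span R M S) R M"
    by (rule submodule_sum[OF cy sp])
  have "x = \<one> \<odot>\<^bsub>M\<^esub> x \<oplus>\<^bsub>M\<^esub> \<zero>\<^bsub>M\<^esub>" using assms by simp
  moreover have "s = \<zero> \<odot>\<^bsub>M\<^esub> x \<oplus>\<^bsub>M\<^esub> s" if "s \<in> S" for s using that assms by (auto simp: subset_iff)
  ultimately show "insert x S \<subseteq> (\<lambda>r. r \<odot>\<^bsub>M\<^esub> x) ` carrier R <+>\<^bsub>M\<^esub> submodule_span R M S"
    using submodule_zero_mem[OF sp] submodule_span_superset[of S]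
    unfolding set_add_def' by (auto; blast)
qed

text \<open>The coefficients with which \<open>x\<close> occurs in the elements of \<open>N\<close>, taken modulo \<open>B\<close>. For
  \<open>B = {\<zero>}\<close> this is the residual ideal \<open>(N : x)\<close>.\<close>

lemma ideal_leading_coefficients:
  assumes N: "submodule N R M" and B: "submodule B R M" and x: "x \<in> carrier M"
  shows "ideal {r \<in> carrier R. \<exists>u\<in>B. r \<odot>\<^bsub>M\<^esub> x \<oplus>\<^bsub>M\<^esub> u \<in> N} R" (is "ideal ?L R")
proof -
  note N' = submoduleE[OF N] and B' = submoduleE[OF B]
  have c: "u \<in> carrier M" if "u \<in> B" for u using B'(1) that by blast
  have zero: "\<zero> \<in> ?L" using x submodule_zero_mem[OF N] submodule_zero_mem[OF B] by force
  have add: "a \<oplus> b \<in> ?L" if ab: "a \<in> ?L" "b \<in> ?L" for a b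
  proof -
    from ab obtain u v where uv: "a \<in> carrier R" "b \<in> carrier R" "u \<in> B" "v \<in> B"
      "a \<odot>\<^bsub>M\<^esub> x \<oplus>\<^bsub>M\<^esub> u \<in> N" "b \<odot>\<^bsub>M\<^esub> x \<oplus>\<^bsub>M\<^esub> v \<in> N" by blast
    have "(a \<oplus> b) \<odot>\<^bsub>M\<^esub> x \<oplus>\<^bsub>M\<^esub> (u \<oplus>\<^bsub>M\<^esub> v) = (a \<odot>\<^bsub>M\<^esub> x \<oplus>\<^bsub>M\<^esub> u) \<oplus>\<^bsub>M\<^esub> (b \<odot>\<^bsub>M\<^esub> x \<oplus>\<^bsub>M\<^esub> v)"
      using uv c x by (simp add: smult_l_distr M.a_ac)
    then have "(a \<oplus> b) \<odot>\<^bsub>M\<^esub> x \<oplus>\<^bsub>M\<^esub> (u \<oplus>\<^bsub>M\<^esub> v) \<in> N" using N'(5) uv by simp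
    then show ?thesis using uv B'(5) by blast
  qed
  have mult: "r \<otimes> a \<in> ?L" if ra: "r \<in> carrier R" "a \<in> ?L" for r a
  proof -
    from ra obtain u where u: "a \<in> carrier R" "u \<in> B" "a \<odot>\<^bsub>M\<^esub> x \<oplus>\<^bsub>M\<^esub> u \<in> N" by blast
    have "(r \<otimes> a) \<odot>\<^bsub>M\<^esub> x \<oplus>\<^bsub>M\<^esub> r \<odot>\<^bsub>M\<^esub> u = r \<odot>\<^bsub>M\<^esub> (a \<odot>\<^bsub>M\<^esub> x \<oplus>\<^bsub>M\<^esub> u)"
      using u c x ra by (simp add: smult_r_distr smult_assoc1)
    then have "(r \<otimes> a) \<odot>\<^bsub>M\<^esub> x \<oplus>\<^bsub>M\<^esub> r \<odot>\<^bsub>M\<^esub> u \<in> N" using N'(4) u ra by simp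
    then show ?thesis using u ra B'(4) by blast
  qed
  have car: "?L \<subseteq> carrier R" by blast
  show ?thesis
  proof (rule idealI[OF R.ring_axioms])
    show "subgroup ?L (add_monoid R)"
    proof (rule R.add.subgroupI[OF car], goal_cases)
      case 1 then show ?case using zero by blast
    next
      case (2 a)
      then have "\<ominus> \<one> \<otimes> a \<in> ?L" by (intro mult) auto
      moreover have "\<ominus> \<one> \<otimes> a = \<ominus> a" using 2 by (simp add: R.l_minus)
      ultimately show ?case by (simp add: a_inv_def)
    next
      case (3 a b) then show ?case using add[of a b] by blast
    qed
    show "r \<otimes> a \<in> ?L" if "a \<in> ?L" "r \<in> carrier R" for a r using mult that by blast
    show "a \<otimes> r \<in> ?L" if "a \<in> ?L" "r \<in> carrier R" for a r
      using mult[of r a] that car by (metis (no_types, lifting) R.m_comm subsetD)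
  qed
qed

text \<open>Finitely generated modules over a Noetherian ring are Noetherian, by induction on the
  generators: a submodule of \<open>R x + B\<close> is determined, among the submodules above it, by its intersection
  with \<open>B\<close> and the ideal of its coefficients at \<open>x\<close>.\<close>

lemma acc_submodules_of_span:
  assumes noeth: "acc_on {J. ideal J R}" and S: "finite S" "S \<subseteq> carrier M"
  shows "acc_on {N. submodule N R M \<and> N \<subseteq> submodule_span R M S}"
  using S
proof (induction S)
  case empty
  have "submodule {\<zero>\<^bsub>M\<^esub>} R M" by (rule submoduleI) auto
  then have "submodule_span R M {} \<subseteq> {\<zero>\<^bsub>M\<^esub>}" by (rule submodule_span_minimal) simp
  then have "N = {\<zero>\<^bsub>M\<^esub>}" if "submodule N R M \<and> N \<subseteq> submodule_span R M {}" for N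
    using that submodule_zero_mem[of N] by blast
  then show ?case unfolding acc_on_def by (metis mem_Collect_eq)
next
  case (insert x S)
  let ?B = "submodule_span R M S"
  let ?L = "\<lambda>N. {r \<in> carrier R. \<exists>u\<in>?B. r \<odot>\<^bsub>M\<^esub> x \<oplus>\<^bsub>M\<^esub> u \<in> N}"
  from insert have x: "x \<in> carrier M" and S: "S \<subseteq> carrier M" by auto
  note B = submodule_span_submodule[OF S] note B' = submoduleE[OF B]
  show ?case
    unfolding acc_on_def
  proof (intro allI impI)
    fix f :: "nat \<Rightarrow> 'c set"
    assume f: "\<forall>k. f k \<in> {N. submodule N R M \<and> N \<subseteq> submodule_span R M (insert x S)} \<and> f k \<le> f (Suc k)"
    have le: "f i \<subseteq> f j" if "i \<le> j" for i j using lift_Suc_mono_le[of f] f that by blast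
    have sub: "submodule (f k) R M" for k using f by blast
    have int: "submodule (f k \<inter> ?B) R M" for k
      by (rule submoduleI) (use submoduleE[OF sub] B' submodule_zero_mem[OF sub] submodule_zero_mem[OF B] in auto)
    obtain k1 where k1: "\<And>k. k \<ge> k1 \<Longrightarrow> f k \<inter> ?B = f k1 \<inter> ?B"
      using acc_onD[OF insert.IH[OF S], of "\<lambda>k. f k \<inter> ?B"] int f by blast
    have "?L (f k) \<in> {J. ideal J R}" for k using ideal_leading_coefficients[OF sub B x] by blast
    moreover have "?L (f k) \<subseteq> ?L (f (Suc k))" for k using f by blast
    ultimately obtain k2 where k2: "\<And>k. k \<ge> k2 \<Longrightarrow> ?L (f k) = ?L (f k2)"
      using acc_onD[OF noeth, of "\<lambda>k. ?L (f k)"] by blast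
    define k0 where "k0 = max k1 k2"
    have "f k \<subseteq> f k0" if k: "k \<ge> k0" for k
    proof
      fix m assume m: "m \<in> f k"
      then have "m \<in> (\<lambda>r. r \<odot>\<^bsub>M\<^esub> x) ` carrier R <+>\<^bsub>M\<^esub> ?B"
        using f submodule_span_insert[OF x S] by blast
      then obtain r u where ru: "r \<in> carrier R" "u \<in> ?B" "m = r \<odot>\<^bsub>M\<^esub> x \<oplus>\<^bsub>M\<^esub> u"
        by (auto simp: set_add_def')
      have "r \<in> ?L (f k)" using ru m by blast
      moreover have "?L (f k) = ?L (f k0)" using k2[of k] k2[of k0] k unfolding k0_def by simp
      ultimately have "r \<in> ?L (f k0)" by blast
      then obtain v where v: "v \<in> ?B" "r \<odot>\<^bsub>M\<^esub> x \<oplus>\<^bsub>M\<^esub> v \<in> f k0" by blast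
      let ?m = "r \<odot>\<^bsub>M\<^esub> x \<oplus>\<^bsub>M\<^esub> v"
      have cc: "u \<in> carrier M" "v \<in> carrier M" "r \<odot>\<^bsub>M\<^esub> x \<in> carrier M" using ru v B'(1) x by blast+
      \<comment> \<open>The coefficient at \<open>x\<close> cancels, so the difference lies in \<open>B\<close>.\<close>
      have "m \<ominus>\<^bsub>M\<^esub> ?m = u \<ominus>\<^bsub>M\<^esub> v"
      proof -
        have "m \<ominus>\<^bsub>M\<^esub> ?m = (r \<odot>\<^bsub>M\<^esub> x \<oplus>\<^bsub>M\<^esub> \<ominus>\<^bsub>M\<^esub> (r \<odot>\<^bsub>M\<^esub> x)) \<oplus>\<^bsub>M\<^esub> (u \<oplus>\<^bsub>M\<^esub> \<ominus>\<^bsub>M\<^esub> v)"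
          using cc by (simp add: ru(3) a_minus_def M.minus_add M.a_ac del: M.r_neg)
        then show ?thesis using cc by (simp add: M.r_neg a_minus_def)
      qed
      moreover have "u \<ominus>\<^bsub>M\<^esub> v \<in> ?B" using submodule_minus_closed[OF B] ru v by blast
      moreover have "m \<ominus>\<^bsub>M\<^esub> ?m \<in> f k" using submodule_minus_closed[OF sub] m v le[OF k] by blast
      ultimately have "m \<ominus>\<^bsub>M\<^esub> ?m \<in> f k \<inter> ?B" by simp
      then have "m \<ominus>\<^bsub>M\<^esub> ?m \<in> f k0" using k1[of k] k1[of k0] k unfolding k0_def by auto
      then have "(m \<ominus>\<^bsub>M\<^esub> ?m) \<oplus>\<^bsub>M\<^esub> ?m \<in> f k0" using submoduleE(5)[OF sub] v by blast
      moreover have "(m \<ominus>\<^bsub>M\<^esub> ?m) \<oplus>\<^bsub>M\<^esub> ?m = m"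
        using cc by (simp add: ru(3) a_minus_def M.a_assoc M.l_neg)
      ultimately show "m \<in> f k0" by simp
    qed
    then show "\<exists>k0. \<forall>k\<ge>k0. f k = f k0" using le by (metis subset_antisym)
  qed
qed

end

section \<open>Graded submodules of the Rees module\<close>

text \<open>\<open>rees M as n\<close> is \<open>J\<^sup>n M\<close> for the ideal \<open>J\<close> generated by \<open>as\<close>, in the form
  \<open>\<Sum>i\<le>n. a\<^sup>i J'\<^sup>(\<^sup>n\<^sup>-\<^sup>i\<^sup>) M\<close>, where \<open>a\<close> is the first generator and \<open>J'\<close> is generated by the others. This
  form makes induction on the number of generators possible without a polynomial ring. Together the
  degrees are the homogeneous components of the Rees module \<open>\<Oplus>n. J\<^sup>n M\<close>.\<close>

fun rees :: "('a, 'e, 'm) module_scheme \<Rightarrow> 'a list \<Rightarrow> nat \<Rightarrow> 'e set" where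
  "rees M [] n = (if n = 0 then carrier M else {\<zero>\<^bsub>M\<^esub>})"
| "rees M (a # as) 0 = carrier M"
| "rees M (a # as) (Suc n) = (\<lambda>x. a \<odot>\<^bsub>M\<^esub> x) ` rees M (a # as) n <+>\<^bsub>M\<^esub> rees M as (Suc n)"

text \<open>The part of degree \<open>n\<close> that \<open>a\<close> brings in, namely \<open>a\<close> times the part of degree \<open>n - 1\<close>; degree
  \<open>-1\<close> counts as zero.\<close>

fun rees_multiples :: "('a, 'e, 'm) module_scheme \<Rightarrow> 'a \<Rightarrow> 'a list \<Rightarrow> nat \<Rightarrow> 'e set" where
  "rees_multiples M a as 0 = {\<zero>\<^bsub>M\<^esub>}"
| "rees_multiples M a as (Suc n) = (\<lambda>x. a \<odot>\<^bsub>M\<^esub> x) ` rees M (a # as) n"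

text \<open>The homogeneous components of the graded submodules of \<open>G\<close>, where the elements of \<open>S\<close> act with
  degree one.\<close>

definition graded_submodules ::
    "('a, 'r) ring_scheme \<Rightarrow> ('a, 'e, 'm) module_scheme \<Rightarrow> 'a set \<Rightarrow> (nat \<Rightarrow> 'e set) \<Rightarrow> (nat \<Rightarrow> 'e set) set"
  where "graded_submodules R M S G =
    {N. \<forall>n. submodule (N n) R M \<and> N n \<subseteq> G n \<and> (\<forall>b\<in>S. \<forall>x\<in>N n. b \<odot>\<^bsub>M\<^esub> x \<in> N (Suc n))}"

lemma graded_submodulesD:
  assumes "N \<in> graded_submodules R M S G"
  shows "submodule (N n) R M" "N n \<subseteq> G n" "\<And>b x. b \<in> S \<Longrightarrow> x \<in> N n \<Longrightarrow> b \<odot>\<^bsub>M\<^esub> x \<in> N (Suc n)"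
  using assms unfolding graded_submodules_def by blast+

context module begin

lemma submodule_zero: "submodule {\<zero>\<^bsub>M\<^esub>} R M"
  by (rule submoduleI) auto

lemma rees_0: "rees M as 0 = carrier M"
  by (cases as) auto

lemma submodule_rees: "set as \<subseteq> carrier R \<Longrightarrow> submodule (rees M as n) R M"
proof (induction as arbitrary: n)
  case Nil
  then show ?case using submodule_zero carrier_is_submodule by simp
next
  case (Cons a as)
  show ?case
  proof (induction n)
    case 0 then show ?case using carrier_is_submodule by simp
  next
    case (Suc n)
    have "a \<in> carrier R" using Cons.prems by simp
    from submodule_sum[OF submodule_smult_image[OF this Suc.IH]] show ?case
      using Cons by simp
  qed
qed

lemma rees_carrier: "set as \<subseteq> carrier R \<Longrightarrow> x \<in> rees M as n \<Longrightarrow> x \<in> carrier M"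
  using submoduleE(1)[OF submodule_rees] by blast

lemma submodule_rees_multiples:
  "set (a # as) \<subseteq> carrier R \<Longrightarrow> submodule (rees_multiples M a as n) R M"
  using submodule_zero submodule_smult_image submodule_rees[of "a # as"] by (cases n) auto

lemma rees_Cons:
  assumes "set as \<subseteq> carrier R"
  shows "rees M (a # as) n = rees_multiples M a as n <+>\<^bsub>M\<^esub> rees M as n"
proof (cases n)
  case 0
  have "carrier M = {\<zero>\<^bsub>M\<^esub>} <+>\<^bsub>M\<^esub> carrier M" by (auto simp: set_add_def')
  then show ?thesis using 0 rees_0[of as] by simp
qed simp

lemma rees_smult:
  assumes "set as \<subseteq> carrier R" "b \<in> set as" "x \<in> rees M as n"
  shows "b \<odot>\<^bsub>M\<^esub> x \<in> rees M as (Suc n)"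
  using assms
proof (induction as arbitrary: x n)
  case (Cons a as)
  from Cons.prems have as: "set as \<subseteq> carrier R" and a: "a \<in> carrier R" and b: "b \<in> carrier R" by auto
  note car = rees_carrier[OF Cons.prems(1)] rees_carrier[OF as]
  show ?case
  proof (cases "b = a")
    case True
    have "a \<odot>\<^bsub>M\<^esub> x \<oplus>\<^bsub>M\<^esub> \<zero>\<^bsub>M\<^esub> \<in> rees M (a # as) (Suc n)"
      unfolding rees.simps using Cons.prems(3) submodule_zero_mem[OF submodule_rees[OF as]]
      by (intro set_addI) auto
    then show ?thesis using True a car(1)[OF Cons.prems(3)] by simp
  next
    case False
    then have bs: "b \<in> set as" using Cons.prems by simp
    show ?thesis using Cons.prems(3)
    proof (induction n arbitrary: x)
      case 0
      have "b \<odot>\<^bsub>M\<^esub> x \<in> rees M as (Suc 0)" using Cons.IH[OF as bs] 0 rees_0[of as] by simp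
      then have "a \<odot>\<^bsub>M\<^esub> \<zero>\<^bsub>M\<^esub> \<oplus>\<^bsub>M\<^esub> b \<odot>\<^bsub>M\<^esub> x \<in> rees M (a # as) (Suc 0)"
        unfolding rees.simps by (intro set_addI) auto
      then show ?case using 0 a b by simp
    next
      case (Suc n)
      then obtain u g where ug: "u \<in> rees M (a # as) n" "g \<in> rees M as (Suc n)" "x = a \<odot>\<^bsub>M\<^esub> u \<oplus>\<^bsub>M\<^esub> g"
        by (auto simp: set_add_def')
      have uM: "u \<in> carrier M" and gM: "g \<in> carrier M" using car ug by blast+
      have "b \<odot>\<^bsub>M\<^esub> (a \<odot>\<^bsub>M\<^esub> u) = a \<odot>\<^bsub>M\<^esub> (b \<odot>\<^bsub>M\<^esub> u)"
        using a b uM by (metis smult_assoc1 R.m_comm)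
      then have "b \<odot>\<^bsub>M\<^esub> x = a \<odot>\<^bsub>M\<^esub> (b \<odot>\<^bsub>M\<^esub> u) \<oplus>\<^bsub>M\<^esub> b \<odot>\<^bsub>M\<^esub> g"
        using ug a b uM gM by (simp add: smult_r_distr)
      also have "\<dots> \<in> rees M (a # as) (Suc (Suc n))"
        unfolding rees.simps(3)[of M a as "Suc n"] using Suc.IH[OF ug(1)] Cons.IH[OF as bs ug(2)]
        by (intro set_addI) auto
      finally show ?case .
    qed
  qed
qed simp

lemma rees_multiples_smult:
  assumes as: "set (a # as) \<subseteq> carrier R" "b \<in> set as" and x: "x \<in> rees_multiples M a as n"
  shows "b \<odot>\<^bsub>M\<^esub> x \<in> rees_multiples M a as (Suc n)"
proof (cases n)
  case 0
  then have "b \<odot>\<^bsub>M\<^esub> x = \<zero>\<^bsub>M\<^esub>" using x as by auto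
  then show ?thesis using submodule_zero_mem[OF submodule_rees_multiples[OF as(1)]] by metis
next
  case (Suc i)
  then obtain w where w: "w \<in> rees M (a # as) i" "x = a \<odot>\<^bsub>M\<^esub> w" using x by auto
  have "b \<odot>\<^bsub>M\<^esub> x = a \<odot>\<^bsub>M\<^esub> (b \<odot>\<^bsub>M\<^esub> w)"
    using as w rees_carrier[OF as(1) w(1)] by (metis list.set_intros smult_assoc1 R.m_comm subsetD)
  moreover have "b \<odot>\<^bsub>M\<^esub> w \<in> rees M (a # as) (Suc i)" using rees_smult[OF as(1) _ w(1)] as(2) by simp
  ultimately show ?thesis unfolding Suc by (simp only: rees_multiples.simps) blast
qed

text \<open>The coefficients \<open>e\<close> of the lowest power \<open>a\<^sup>d\<close> in those elements of \<open>N\<close> of degree \<open>j + d\<close> that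
  have the form \<open>a\<^sup>d e + a\<^sup>d\<^sup>+\<^sup>1 (\<dots>)\<close>, with \<open>e\<close> built from the remaining generators.\<close>

definition initial_coefficients :: "'a \<Rightarrow> 'a list \<Rightarrow> nat \<Rightarrow> (nat \<Rightarrow> 'c set) \<Rightarrow> nat \<Rightarrow> 'c set"
  where "initial_coefficients a as d N j =
    {e \<in> rees M as j. \<exists>u\<in>rees_multiples M a as j. (a [^] d) \<odot>\<^bsub>M\<^esub> (e \<oplus>\<^bsub>M\<^esub> u) \<in> N (j + d)}"

lemma initial_coefficients_graded:
  assumes as: "set (a # as) \<subseteq> carrier R"
    and N: "N \<in> graded_submodules R M (set (a # as)) (rees M (a # as))"
  shows "initial_coefficients a as d N \<in> graded_submodules R M (set as) (rees M as)"
proof -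
  let ?L = "initial_coefficients a as d N" and ?U = "rees_multiples M a as"
  have a: "a \<in> carrier R" and as': "set as \<subseteq> carrier R" using as by auto
  note Nsub = graded_submodulesD(1)[OF N] and Nsm = graded_submodulesD(3)[OF N]
  note G = submodule_rees[OF as'] and U = submodule_rees_multiples[OF as]
  have ad: "a [^] d \<in> carrier R" using a by simp
  have car: "x \<in> carrier M" if "x \<in> rees M as j \<or> x \<in> ?U j" for x j
    using submoduleE(1)[OF G] submoduleE(1)[OF U] that by blast
  have L1: "e \<in> ?L j" if "e \<in> rees M as j" "u \<in> ?U j" "(a [^] d) \<odot>\<^bsub>M\<^esub> (e \<oplus>\<^bsub>M\<^esub> u) \<in> N (j + d)" for e u j
    using that unfolding initial_coefficients_def by blast
  have L2: "\<exists>u. e \<in> rees M as j \<and> u \<in> ?U j \<and> (a [^] d) \<odot>\<^bsub>M\<^esub> (e \<oplus>\<^bsub>M\<^esub> u) \<in> N (j + d)" if "e \<in> ?L j" for e j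
    using that unfolding initial_coefficients_def by blast
  have smult_in: "b \<odot>\<^bsub>M\<^esub> ((a [^] d) \<odot>\<^bsub>M\<^esub> (e \<oplus>\<^bsub>M\<^esub> u)) = (a [^] d) \<odot>\<^bsub>M\<^esub> (b \<odot>\<^bsub>M\<^esub> e \<oplus>\<^bsub>M\<^esub> b \<odot>\<^bsub>M\<^esub> u)"
    if "b \<in> carrier R" "e \<in> carrier M" "u \<in> carrier M" for b e u
  proof -
    have "b \<odot>\<^bsub>M\<^esub> ((a [^] d) \<odot>\<^bsub>M\<^esub> (e \<oplus>\<^bsub>M\<^esub> u)) = (a [^] d) \<odot>\<^bsub>M\<^esub> (b \<odot>\<^bsub>M\<^esub> (e \<oplus>\<^bsub>M\<^esub> u))"
      using that ad by (metis smult_assoc1 R.m_comm M.add.m_closed)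
    then show ?thesis using that by (simp add: smult_r_distr)
  qed
  have "submodule (?L j) R M" for j
  proof (rule submoduleI)
    show "?L j \<subseteq> carrier M" using L2 car by blast
    show "\<zero>\<^bsub>M\<^esub> \<in> ?L j"
      by (rule L1[of _ _ "\<zero>\<^bsub>M\<^esub>"])
        (use ad submodule_zero_mem[OF G] submodule_zero_mem[OF U] submodule_zero_mem[OF Nsub] in auto)
    have sm: "b \<odot>\<^bsub>M\<^esub> e \<in> ?L j" if be: "b \<in> carrier R" "e \<in> ?L j" for b e
    proof -
      obtain u where u: "e \<in> rees M as j" "u \<in> ?U j" "(a [^] d) \<odot>\<^bsub>M\<^esub> (e \<oplus>\<^bsub>M\<^esub> u) \<in> N (j + d)"
        using L2 be(2) by blast
      have "b \<odot>\<^bsub>M\<^esub> ((a [^] d) \<odot>\<^bsub>M\<^esub> (e \<oplus>\<^bsub>M\<^esub> u)) \<in> N (j + d)" using submoduleE(4)[OF Nsub] u(3) be by blast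
      then show ?thesis
        using L1[OF submoduleE(4)[OF G be(1) u(1)] submoduleE(4)[OF U be(1) u(2)]]
          smult_in[OF be(1) car[of e j] car[of u j]] u by simp
    qed
    show "b \<odot>\<^bsub>M\<^esub> e \<in> ?L j" if "b \<in> carrier R" "e \<in> ?L j" for b e by (rule sm[OF that])
    show "\<ominus>\<^bsub>M\<^esub> e \<in> ?L j" if e: "e \<in> ?L j" for e
    proof -
      have "e \<in> carrier M" using L2[OF e] car by blast
      then have "\<ominus>\<^bsub>M\<^esub> e = (\<ominus> \<one>) \<odot>\<^bsub>M\<^esub> e" by (simp add: smult_l_minus)
      then show ?thesis using sm[of "\<ominus> \<one>"] e by simp
    qed
    show "e \<oplus>\<^bsub>M\<^esub> e' \<in> ?L j" if e: "e \<in> ?L j" "e' \<in> ?L j" for e e'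
    proof -
      obtain u where u: "e \<in> rees M as j" "u \<in> ?U j" "(a [^] d) \<odot>\<^bsub>M\<^esub> (e \<oplus>\<^bsub>M\<^esub> u) \<in> N (j + d)"
        using L2 e(1) by blast
      obtain u' where u': "e' \<in> rees M as j" "u' \<in> ?U j" "(a [^] d) \<odot>\<^bsub>M\<^esub> (e' \<oplus>\<^bsub>M\<^esub> u') \<in> N (j + d)"
        using L2 e(2) by blast
      have c: "e \<in> carrier M" "u \<in> carrier M" "e' \<in> carrier M" "u' \<in> carrier M" using car u u' by blast+
      then have "(e \<oplus>\<^bsub>M\<^esub> e') \<oplus>\<^bsub>M\<^esub> (u \<oplus>\<^bsub>M\<^esub> u') = (e \<oplus>\<^bsub>M\<^esub> u) \<oplus>\<^bsub>M\<^esub> (e' \<oplus>\<^bsub>M\<^esub> u')"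
        by (simp add: M.a_ac)
      then have "(a [^] d) \<odot>\<^bsub>M\<^esub> ((e \<oplus>\<^bsub>M\<^esub> e') \<oplus>\<^bsub>M\<^esub> (u \<oplus>\<^bsub>M\<^esub> u'))
          = (a [^] d) \<odot>\<^bsub>M\<^esub> (e \<oplus>\<^bsub>M\<^esub> u) \<oplus>\<^bsub>M\<^esub> (a [^] d) \<odot>\<^bsub>M\<^esub> (e' \<oplus>\<^bsub>M\<^esub> u')"
        using c ad by (simp add: smult_r_distr)
      also have "\<dots> \<in> N (j + d)" using submoduleE(5)[OF Nsub] u(3) u'(3) by blast
      finally show ?thesis
        by (rule L1[OF submoduleE(5)[OF G u(1) u'(1)] submoduleE(5)[OF U u(2) u'(2)]])
    qed
  qed
  moreover have "?L j \<subseteq> rees M as j" for j using L2 by blast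
  moreover have "b \<odot>\<^bsub>M\<^esub> e \<in> ?L (Suc j)" if be: "b \<in> set as" "e \<in> ?L j" for b e j
  proof -
    obtain u where u: "e \<in> rees M as j" "u \<in> ?U j" "(a [^] d) \<odot>\<^bsub>M\<^esub> (e \<oplus>\<^bsub>M\<^esub> u) \<in> N (j + d)"
      using L2 be(2) by blast
    have b: "b \<in> carrier R" using be as' by blast
    have "b \<odot>\<^bsub>M\<^esub> ((a [^] d) \<odot>\<^bsub>M\<^esub> (e \<oplus>\<^bsub>M\<^esub> u)) \<in> N (Suc (j + d))" using Nsm[OF _ u(3)] be by simp
    then show ?thesis
      using L1[OF rees_smult[OF as' be(1) u(1)] rees_multiples_smult[OF as be(1) u(2)]]
        smult_in[OF b car[of e j] car[of u j]] u by simp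
  qed
  ultimately show ?thesis unfolding graded_submodules_def by blast
qed

lemma initial_coefficients_Suc:
  assumes as: "set (a # as) \<subseteq> carrier R"
    and N: "N \<in> graded_submodules R M (set (a # as)) (rees M (a # as))"
  shows "initial_coefficients a as d N \<le> initial_coefficients a as (Suc d) N"
proof (rule le_funI, rule subsetI)
  fix j e assume "e \<in> initial_coefficients a as d N j"
  then obtain u where u: "e \<in> rees M as j" "u \<in> rees_multiples M a as j"
      "(a [^] d) \<odot>\<^bsub>M\<^esub> (e \<oplus>\<^bsub>M\<^esub> u) \<in> N (j + d)" unfolding initial_coefficients_def by blast
  have "e \<in> carrier M" "u \<in> carrier M"
    using rees_carrier[of as] submoduleE(1)[OF submodule_rees_multiples[OF as]] u as by auto
  then have "(a [^] Suc d) \<odot>\<^bsub>M\<^esub> (e \<oplus>\<^bsub>M\<^esub> u) = a \<odot>\<^bsub>M\<^esub> ((a [^] d) \<odot>\<^bsub>M\<^esub> (e \<oplus>\<^bsub>M\<^esub> u))"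
    using as by (simp add: smult_assoc1[symmetric] R.m_comm)
  also have "\<dots> \<in> N (Suc (j + d))" using graded_submodulesD(3)[OF N _ u(3)] by simp
  finally show "e \<in> initial_coefficients a as (Suc d) N j"
    using u unfolding initial_coefficients_def by auto
qed

text \<open>An element of \<open>N'\<close> has in \<open>N\<close> a partner with the same initial coefficient, and the difference
  is divisible by one more power of \<open>a\<close>. The degree bounds the power of \<open>a\<close>, so after finitely many
  such corrections nothing remains.\<close>

lemma initial_coefficients_determine:
  assumes as: "set (a # as) \<subseteq> carrier R"
    and N: "N \<in> graded_submodules R M (set (a # as)) (rees M (a # as))"
    and N': "N' \<in> graded_submodules R M (set (a # as)) (rees M (a # as))"
    and le: "N \<le> N'"
    and eq: "\<And>d. initial_coefficients a as d N' = initial_coefficients a as d N"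
  shows "N' \<le> N"
proof -
  have a: "a \<in> carrier R" and as': "set as \<subseteq> carrier R" using as by auto
  note Nsub = graded_submodulesD(1)[OF N] and Nsub' = graded_submodulesD(1)[OF N']
  note U = submodule_rees_multiples[OF as]
  have car: "x \<in> carrier M" if "x \<in> rees M as j \<or> x \<in> rees_multiples M a as j" for x j
    using rees_carrier[OF as'] submoduleE(1)[OF U] that by blast
  have step: "\<exists>z\<in>rees_multiples M a as j. (a [^] d) \<odot>\<^bsub>M\<^esub> z \<in> N' (j + d)
      \<and> ((a [^] d) \<odot>\<^bsub>M\<^esub> z \<in> N (j + d) \<longrightarrow> (a [^] d) \<odot>\<^bsub>M\<^esub> w \<in> N (j + d))"
    if w: "w \<in> rees M (a # as) j" and m: "(a [^] d) \<odot>\<^bsub>M\<^esub> w \<in> N' (j + d)" for w j d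
  proof -
    have ad: "a [^] d \<in> carrier R" using a by simp
    obtain u e where ue: "u \<in> rees_multiples M a as j" "e \<in> rees M as j" "w = u \<oplus>\<^bsub>M\<^esub> e"
      using w unfolding rees_Cons[OF as'] by (auto simp: set_add_def')
    have c: "u \<in> carrier M" "e \<in> carrier M" using ue car by blast+
    have "e \<in> initial_coefficients a as d N' j"
      using ue m c unfolding initial_coefficients_def by (auto simp: M.a_comm)
    then obtain v where v: "v \<in> rees_multiples M a as j" "(a [^] d) \<odot>\<^bsub>M\<^esub> (e \<oplus>\<^bsub>M\<^esub> v) \<in> N (j + d)"
      unfolding eq unfolding initial_coefficients_def by blast
    have cv: "v \<in> carrier M" using car v by blast
    \<comment> \<open>This remainder, free of the common initial coefficient, is the witness.\<close>
    have uv: "u \<ominus>\<^bsub>M\<^esub> v \<in> rees_multiples M a as j" by (rule submodule_minus_closed[OF U ue(1) v(1)])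
    have "w = (u \<ominus>\<^bsub>M\<^esub> v) \<oplus>\<^bsub>M\<^esub> (e \<oplus>\<^bsub>M\<^esub> v)"
    proof -
      have "(u \<ominus>\<^bsub>M\<^esub> v) \<oplus>\<^bsub>M\<^esub> (e \<oplus>\<^bsub>M\<^esub> v) = (u \<oplus>\<^bsub>M\<^esub> e) \<oplus>\<^bsub>M\<^esub> (\<ominus>\<^bsub>M\<^esub> v \<oplus>\<^bsub>M\<^esub> v)"
        unfolding a_minus_def using c cv by (simp add: M.a_ac del: M.l_neg M.r_neg)
      then show ?thesis using ue c cv by (simp add: M.l_neg)
    qed
    then have split: "(a [^] d) \<odot>\<^bsub>M\<^esub> w
        = (a [^] d) \<odot>\<^bsub>M\<^esub> (u \<ominus>\<^bsub>M\<^esub> v) \<oplus>\<^bsub>M\<^esub> (a [^] d) \<odot>\<^bsub>M\<^esub> (e \<oplus>\<^bsub>M\<^esub> v)" (is "?m = ?h \<oplus>\<^bsub>M\<^esub> ?l")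
      using c cv ad by (simp add: smult_r_distr)
    have hl: "?h \<in> carrier M" "?l \<in> carrier M" using c cv ad by auto
    have "?h = (?h \<oplus>\<^bsub>M\<^esub> ?l) \<ominus>\<^bsub>M\<^esub> ?l"
      using hl unfolding a_minus_def[of M "_ \<oplus>\<^bsub>M\<^esub> _"] by (simp add: M.a_assoc M.r_neg)
    then have "?h = ?m \<ominus>\<^bsub>M\<^esub> ?l" unfolding split .
    moreover have "?l \<in> N' (j + d)" using v le by (auto simp: le_fun_def)
    ultimately have h: "?h \<in> N' (j + d)" using submodule_minus_closed[OF Nsub' m] by simp
    have fin: "?m \<in> N (j + d)" if "?h \<in> N (j + d)"
      unfolding split using submoduleE(5)[OF Nsub that v(2)] .
    show ?thesis using uv h fin by blast
  qed
  have claim: "(a [^] d) \<odot>\<^bsub>M\<^esub> w \<in> N (j + d)"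
    if "w \<in> rees M (a # as) j" "(a [^] d) \<odot>\<^bsub>M\<^esub> w \<in> N' (j + d)" for w j d
    using that
  proof (induction j arbitrary: w d)
    case 0
    then show ?case using step[OF 0] a submodule_zero_mem[OF Nsub] by auto
  next
    case (Suc j)
    obtain z where z: "z \<in> rees_multiples M a as (Suc j)" "(a [^] d) \<odot>\<^bsub>M\<^esub> z \<in> N' (Suc j + d)"
        "(a [^] d) \<odot>\<^bsub>M\<^esub> z \<in> N (Suc j + d) \<Longrightarrow> (a [^] d) \<odot>\<^bsub>M\<^esub> w \<in> N (Suc j + d)"
      using step[OF Suc.prems] by blast
    then obtain y where y: "y \<in> rees M (a # as) j" "z = a \<odot>\<^bsub>M\<^esub> y" by auto
    have yM: "y \<in> carrier M" by (rule rees_carrier[OF as y(1)])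
    have zy: "(a [^] d) \<odot>\<^bsub>M\<^esub> z = (a [^] Suc d) \<odot>\<^bsub>M\<^esub> y"
      using a yM y(2) by (simp add: smult_assoc1)
    have "(a [^] Suc d) \<odot>\<^bsub>M\<^esub> y \<in> N (j + Suc d)"
      by (rule Suc.IH[OF y(1)]) (use z(2) zy in simp)
    then show ?case using z(3) zy by simp
  qed
  show ?thesis
  proof (rule le_funI, rule subsetI)
    fix n w assume w: "w \<in> N' n"
    then have "w \<in> rees M (a # as) n" using graded_submodulesD(2)[OF N'] by blast
    then show "w \<in> N n" using claim[of w n 0] w rees_carrier[OF as] by simp
  qed
qed

text \<open>The Rees module is Noetherian as a graded module, by induction on the generators of the ideal:
  passing to initial coefficients removes the first generator.\<close>

theorem acc_graded_submodules_rees: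
  assumes noeth: "acc_on {N. submodule N R M}" and as: "set as \<subseteq> carrier R"
  shows "acc_on (graded_submodules R M (set as) (rees M as))"
  using as
proof (induction as)
  case Nil
  show ?case
  proof (rule acc_on_refine[OF noeth, where \<phi> = "\<lambda>_ N. N 0"])
    fix N N' :: "nat \<Rightarrow> 'c set"
    assume N: "N \<in> graded_submodules R M (set []) (rees M [])"
      and N': "N' \<in> graded_submodules R M (set []) (rees M [])"
      and eq: "\<And>d::nat. N' 0 = N 0"
    have "N' n \<subseteq> N n" for n
    proof (cases n)
      case (Suc k)
      then have "N' n \<subseteq> {\<zero>\<^bsub>M\<^esub>}" using graded_submodulesD(2)[OF N', of n] by simp
      then show ?thesis using submodule_zero_mem[OF graded_submodulesD(1)[OF N]] by blast
    qed (use eq in simp)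
    then show "N' \<le> N" by (auto simp: le_fun_def)
  qed (auto simp: graded_submodules_def le_fun_def)
next
  case (Cons a as)
  then have IH: "acc_on (graded_submodules R M (set as) (rees M as))" by simp
  show ?case
  proof (rule acc_on_refine[OF IH, where \<phi> = "initial_coefficients a as"])
    show "initial_coefficients a as d N \<le> initial_coefficients a as d N'" if "N \<le> N'" for d N N'
      using that unfolding initial_coefficients_def le_fun_def by blast
  qed (use Cons.prems initial_coefficients_graded initial_coefficients_Suc
      initial_coefficients_determine in blast)+
qed

end

section \<open>Associated primes\<close>

text \<open>The residual ideal \<open>(N : y)\<close>, which is the annihilator of the class of \<open>y\<close> modulo \<open>N\<close>. It lets
  associated primes of quotients be handled without cosets.\<close>

definition residual :: "('a, 'r) ring_scheme \<Rightarrow> ('a, 'e, 'm) module_scheme \<Rightarrow> 'e set \<Rightarrow> 'e \<Rightarrow> 'a set"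
  where "residual R M N y = {r \<in> carrier R. r \<odot>\<^bsub>M\<^esub> y \<in> N}"

text \<open>Multiply elements of \<open>J a - P\<close> over all \<open>a\<close>; primality keeps the product outside \<open>P\<close>.\<close>

lemma (in cring) prime_avoids_finite_intersection:
  assumes P: "primeideal P R" and "finite S"
    and "\<And>a. a \<in> S \<Longrightarrow> ideal (J a) R \<and> \<not> J a \<subseteq> P"
  obtains r where "r \<in> carrier R" "r \<notin> P" "\<And>a. a \<in> S \<Longrightarrow> r \<in> J a"
proof -
  interpret P: primeideal P R by (rule P)
  from assms(2,3) have "\<exists>r\<in>carrier R. r \<notin> P \<and> (\<forall>a\<in>S. r \<in> J a)"
  proof (induction S)
    case empty
    then show ?case using P.one_imp_carrier P.I_notcarr by auto
  next
    case (insert a S)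
    then obtain r where r: "r \<in> carrier R" "r \<notin> P" "\<forall>b\<in>S. r \<in> J b" by blast
    obtain s where s: "s \<in> J a" "s \<notin> P" using insert.prems[of a] by blast
    have sc: "s \<in> carrier R" using s insert.prems[of a] ideal.Icarr by fast
    have "r \<otimes> s \<in> J b" if "b \<in> insert a S" for b
    proof (cases "b = a")
      case True then show ?thesis using s r insert.prems[of a] ideal.I_l_closed by fast
    next
      case False
      then show ?thesis using sc r that insert.prems[of b] ideal.I_r_closed by fast
    qed
    moreover have "r \<otimes> s \<notin> P" using P.I_prime r sc s by blast
    ultimately show ?case using r sc by blast
  qed
  then show ?thesis using that by blast
qed

lemma ideal_prod_least:
  assumes "ideal J R" "\<And>a b. a \<in> A \<Longrightarrow> b \<in> B \<Longrightarrow> a \<otimes>\<^bsub>R\<^esub> b \<in> J"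
  shows "ideal_prod R A B \<subseteq> J"
proof
  interpret J: ideal J R by (rule assms(1))
  fix x assume "x \<in> ideal_prod R A B"
  then show "x \<in> J" by induction (use assms in auto)
qed

context module begin

lemma ideal_residual:
  assumes "submodule N R M" "y \<in> carrier M"
  shows "ideal (residual R M N y) R"
proof -
  have "residual R M N y = {r \<in> carrier R. \<exists>u\<in>{\<zero>\<^bsub>M\<^esub>}. r \<odot>\<^bsub>M\<^esub> y \<oplus>\<^bsub>M\<^esub> u \<in> N}"
    using assms(2) by (auto simp: residual_def)
  then show ?thesis using ideal_leading_coefficients[OF assms(1) submodule_zero assms(2)] by simp
qed

text \<open>In the domain \<open>R / P\<close>, which is isomorphic to the module generated by the class of \<open>y\<close>, all
  non-zero elements have annihilator \<open>P\<close>.\<close>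

lemma prime_residual_multiple:
  assumes P: "primeideal P R" "P = residual R M N y" and N: "submodule N R M" and y: "y \<in> carrier M"
    and r: "r \<in> carrier R" "r \<notin> P"
  shows "P = residual R M N (r \<odot>\<^bsub>M\<^esub> y)"
proof -
  interpret P: primeideal P R by (rule P(1))
  have "s \<in> P \<longleftrightarrow> s \<otimes> r \<in> P" if "s \<in> carrier R" for s
    using P.I_prime[OF that r(1)] P.I_r_closed r that by blast
  then have "s \<in> residual R M N y \<longleftrightarrow> s \<in> residual R M N (r \<odot>\<^bsub>M\<^esub> y)" if "s \<in> carrier R" for s
    using r(1) y that unfolding P(2) by (simp add: residual_def smult_assoc1)
  then show ?thesis unfolding P(2) by (auto simp: residual_def)
qed

lemma residual_eq_carrier:
  assumes "submodule N R M" "y \<in> N"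
  shows "residual R M N y = carrier R"
  using submoduleE(4)[OF assms(1) _ assms(2)] by (auto simp: residual_def)

text \<open>Let \<open>N \<supseteq> K\<close> be maximal among the graded submodules of \<open>G\<close> that contribute only finitely many
  primes. If \<open>N \<noteq> G\<close>, let \<open>Q\<close> be maximal among the ideals \<open>(N : y)\<close> for homogeneous \<open>y \<notin> N\<close>. The elements
  that \<open>Q\<close> multiplies into \<open>N\<close> form a graded submodule strictly above \<open>N\<close>. For such an element \<open>z\<close>, a prime
  \<open>(K : z)\<close> either comes from a multiple of \<open>z\<close> in \<open>N\<close>, or it equals \<open>(N : z)\<close>, which is \<open>Q\<close> by
  maximality. So only the prime \<open>Q\<close> can be new, against the choice of \<open>N\<close>.\<close>

lemma finite_graded_associated_primes:
  assumes noeth: "acc_on {J. ideal J R}" and acc: "acc_on (graded_submodules R M S G)"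
    and S: "S \<subseteq> carrier R"
    and G: "G \<in> graded_submodules R M S G" and K: "K \<in> graded_submodules R M S G"
  shows "finite {P. primeideal P R \<and> (\<exists>n. \<exists>y\<in>G n. P = residual R M (K n) y)}"
proof -
  let ?gr = "graded_submodules R M S G"
  define pr where "pr N = {P. primeideal P R \<and> (\<exists>n. \<exists>y\<in>N n. P = residual R M (K n) y)}" for N
  define X where "X = {N \<in> ?gr. K \<le> N \<and> finite (pr N)}"
  note Ksub = graded_submodulesD(1)[OF K] and Gsub = graded_submodulesD(1)[OF G]
  have car: "y \<in> carrier M" if "y \<in> G n" for y n using submoduleE(1)[OF Gsub] that by blast
  have "pr K = {}"
    unfolding pr_def using residual_eq_carrier[OF Ksub] primeideal.I_notcarr by fastforce
  then have "K \<in> X" using K unfolding X_def by simp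
  then obtain N where N: "N \<in> X" and Nmax: "\<And>N'. N' \<in> X \<Longrightarrow> N \<le> N' \<Longrightarrow> N' = N"
    using acc_on_maximal[OF acc, of X K] unfolding X_def by blast
  then have Ngr: "N \<in> ?gr" and KN: "K \<le> N" and fin: "finite (pr N)" unfolding X_def by auto
  note Nsub = graded_submodulesD(1)[OF Ngr]
  have "G n \<subseteq> N n" for n
  proof (rule ccontr)
    assume "\<not> G n \<subseteq> N n"
    then obtain y where y: "y \<in> G n" "y \<notin> N n" by blast
    define Y where "Y = {residual R M (N n) y | n y. y \<in> G n \<and> y \<notin> N n}"
    have Y: "Y \<subseteq> {J. ideal J R}" using ideal_residual[OF Nsub] car unfolding Y_def by blast
    have YI: "residual R M (N n) y \<in> Y" if "y \<in> G n" "y \<notin> N n" for n y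
      using that unfolding Y_def by blast
    obtain Q where Q: "Q \<in> Y" and Qmax: "\<And>J. J \<in> Y \<Longrightarrow> Q \<subseteq> J \<Longrightarrow> J = Q"
      using acc_on_maximal[OF noeth Y YI[OF y]] by blast
    then have Qc: "Q \<subseteq> carrier R" unfolding Y_def residual_def by blast
    define N' where "N' n = {z \<in> G n. \<forall>r\<in>Q. r \<odot>\<^bsub>M\<^esub> z \<in> N n}" for n
    have comm: "r \<odot>\<^bsub>M\<^esub> (b \<odot>\<^bsub>M\<^esub> z) = b \<odot>\<^bsub>M\<^esub> (r \<odot>\<^bsub>M\<^esub> z)"
      if "r \<in> carrier R" "b \<in> carrier R" "z \<in> carrier M" for r b z
      using that by (metis smult_assoc1 R.m_comm)
    have sm: "b \<odot>\<^bsub>M\<^esub> z \<in> N' n" if b: "b \<in> carrier R" and z: "z \<in> N' n" for b z n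
    proof -
      have "r \<odot>\<^bsub>M\<^esub> (b \<odot>\<^bsub>M\<^esub> z) \<in> N n" if "r \<in> Q" for r
      proof -
        have "b \<odot>\<^bsub>M\<^esub> (r \<odot>\<^bsub>M\<^esub> z) \<in> N n" using submoduleE(4)[OF Nsub b] z that unfolding N'_def by blast
        then show ?thesis using comm[of r b z] that Qc b car z unfolding N'_def by auto
      qed
      then show ?thesis using submoduleE(4)[OF Gsub b] z unfolding N'_def by blast
    qed
    have "submodule (N' n) R M" for n
    proof (rule submoduleI)
      show "N' n \<subseteq> carrier M" using car unfolding N'_def by blast
      show "\<zero>\<^bsub>M\<^esub> \<in> N' n"
        using submodule_zero_mem[OF Gsub] submodule_zero_mem[OF Nsub] Qc unfolding N'_def by auto
      show "b \<odot>\<^bsub>M\<^esub> z \<in> N' n" if "b \<in> carrier R" "z \<in> N' n" for b z by (rule sm[OF that])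
      show "\<ominus>\<^bsub>M\<^esub> z \<in> N' n" if z: "z \<in> N' n" for z
      proof -
        have "z \<in> carrier M" using car z unfolding N'_def by blast
        then have "\<ominus>\<^bsub>M\<^esub> z = (\<ominus> \<one>) \<odot>\<^bsub>M\<^esub> z" by (simp add: smult_l_minus)
        then show ?thesis using sm[of "\<ominus> \<one>"] z by simp
      qed
      show "w \<oplus>\<^bsub>M\<^esub> z \<in> N' n" if wz: "w \<in> N' n" "z \<in> N' n" for w z
      proof -
        have "r \<odot>\<^bsub>M\<^esub> (w \<oplus>\<^bsub>M\<^esub> z) \<in> N n" if "r \<in> Q" for r
        proof -
          have "r \<odot>\<^bsub>M\<^esub> (w \<oplus>\<^bsub>M\<^esub> z) = r \<odot>\<^bsub>M\<^esub> w \<oplus>\<^bsub>M\<^esub> r \<odot>\<^bsub>M\<^esub> z"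
            using that Qc car wz unfolding N'_def by (intro smult_r_distr) auto
          then show ?thesis using submoduleE(5)[OF Nsub] that wz unfolding N'_def by simp
        qed
        then show ?thesis using submoduleE(5)[OF Gsub] wz unfolding N'_def by blast
      qed
    qed
    moreover have "b \<odot>\<^bsub>M\<^esub> z \<in> N' (Suc n)" if b: "b \<in> S" and z: "z \<in> N' n" for b z n
    proof -
      have "r \<odot>\<^bsub>M\<^esub> (b \<odot>\<^bsub>M\<^esub> z) \<in> N (Suc n)" if "r \<in> Q" for r
      proof -
        have "b \<odot>\<^bsub>M\<^esub> (r \<odot>\<^bsub>M\<^esub> z) \<in> N (Suc n)"
          using graded_submodulesD(3)[OF Ngr b] z that unfolding N'_def by blast
        moreover have "r \<in> carrier R" "b \<in> carrier R" "z \<in> carrier M"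
          using that Qc S b car z unfolding N'_def by blast+
        ultimately show ?thesis by (simp add: comm)
      qed
      then show ?thesis using graded_submodulesD(3)[OF G b] z unfolding N'_def by blast
    qed
    moreover have "N' n \<subseteq> G n" for n unfolding N'_def by blast
    ultimately have N'gr: "N' \<in> ?gr" unfolding graded_submodules_def by blast
    have NN': "N \<le> N'"
    proof (rule le_funI, rule subsetI)
      fix n z assume z: "z \<in> N n"
      then show "z \<in> N' n"
        using graded_submodulesD(2)[OF Ngr] submoduleE(4)[OF Nsub _ z] Qc unfolding N'_def by blast
    qed
    have "pr N' \<subseteq> insert Q (pr N)"
    proof
      fix P assume "P \<in> pr N'"
      then obtain n z where P: "primeideal P R" and z: "z \<in> N' n" "P = residual R M (K n) z"
        unfolding pr_def by blast
      interpret P: primeideal P R by (rule P)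
      have zG: "z \<in> G n" using z unfolding N'_def by blast
      note zM = car[OF zG]
      show "P \<in> insert Q (pr N)"
      proof (cases "\<exists>r\<in>carrier R. r \<notin> P \<and> r \<odot>\<^bsub>M\<^esub> z \<in> N n")
        case True
        then show ?thesis using prime_residual_multiple[OF P z(2) Ksub zM] P unfolding pr_def by blast
      next
        case False
        have "residual R M (N n) z = P"
        proof
          show "residual R M (N n) z \<subseteq> P" using False unfolding residual_def by blast
          show "P \<subseteq> residual R M (N n) z" using KN unfolding z(2) residual_def le_fun_def by blast
        qed
        moreover have "z \<notin> N n"
          using False zM P.one_imp_carrier P.I_notcarr by (metis R.one_closed smult_one)
        moreover have "Q \<subseteq> residual R M (N n) z" using z(1) Qc unfolding N'_def residual_def by blast
        ultimately show ?thesis using Qmax[OF YI[OF zG]] by simp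
      qed
    qed
    then have "N' \<in> X" using N'gr NN' KN fin unfolding X_def by (auto intro: finite_subset)
    then have N'N: "N' = N" using Nmax NN' by blast
    obtain k y where ky: "y \<in> G k" "y \<notin> N k" "Q = residual R M (N k) y" using Q unfolding Y_def by blast
    then have "y \<in> N' k" unfolding N'_def residual_def by blast
    then show False using ky N'N by simp
  qed
  then have "pr G \<subseteq> pr N" unfolding pr_def by blast
  then show ?thesis using fin finite_subset unfolding pr_def by blast
qed

lemma Ass_quotient_module:
  assumes N: "submodule N R M"
  shows "Ass R (quotient_module M N) = {P. primeideal P R \<and> (\<exists>y\<in>carrier M. P = residual R M N y)}"
proof -
  let ?Q = "quotient_module M N"
  have sg: "subgroup N (add_monoid M)" by (rule submodule.axioms(1)[OF N])
  have self: "y \<in> N +>\<^bsub>M\<^esub> y" if "y \<in> carrier M" for y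
    using submodule_zero_mem[OF N] that by (force simp: a_r_coset_def')
  have "annihilator R ?Q (N +>\<^bsub>M\<^esub> y) = residual R M N y" if y: "y \<in> carrier M" for y
  proof -
    have "a \<odot>\<^bsub>?Q\<^esub> (N +>\<^bsub>M\<^esub> y) = \<zero>\<^bsub>?Q\<^esub> \<longleftrightarrow> a \<odot>\<^bsub>M\<^esub> y \<in> N" if a: "a \<in> carrier R" for a
      using quotient_module_smult_coset[OF N a y] self[of "a \<odot>\<^bsub>M\<^esub> y"] a y M.a_coset_join2[OF _ sg]
      by (auto simp: quotient_module_def)
    then show ?thesis unfolding annihilator_def residual_def by blast
  qed
  moreover have "carrier ?Q = {N +>\<^bsub>M\<^esub> y | y. y \<in> carrier M}"
    by (auto simp: quotient_module_def A_RCOSETS_def')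
  ultimately show ?thesis unfolding Ass_def by auto
qed

lemma Ass_subquotient_module:
  assumes F: "submodule F R M" and N: "submodule N R M" and le: "N \<subseteq> F"
  shows "Ass R (quotient_module (M\<lparr>carrier := F\<rparr>) N) = {P. primeideal P R \<and> (\<exists>y\<in>F. P = residual R M N y)}"
proof -
  interpret F: module R "M\<lparr>carrier := F\<rparr>"
    by (rule submodule.submodule_is_module[OF F module_axioms])
  have "module R (M\<lparr>carrier := N\<rparr>)" by (rule submodule.submodule_is_module[OF N module_axioms])
  then have "submodule N R (M\<lparr>carrier := F\<rparr>)" using F.module_incl_imp_submodule[of N] le by simp
  from F.Ass_quotient_module[OF this] show ?thesis by (simp add: residual_def)
qed

end

section \<open>The Ratliff-Rush filtration\<close>

abbreviation power_smult ::
    "('a, 'r) ring_scheme \<Rightarrow> ('a, 'e, 'm) module_scheme \<Rightarrow> 'a set \<Rightarrow> nat \<Rightarrow> 'e set"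
  where "power_smult R M I n \<equiv> ideal_smult R M (ideal_pow R I n) (carrier M)"

abbreviation rr_colon ::
    "('a, 'r) ring_scheme \<Rightarrow> ('a, 'e, 'm) module_scheme \<Rightarrow> 'a set \<Rightarrow> nat \<Rightarrow> nat \<Rightarrow> 'e set"
  where "rr_colon R M I n m \<equiv> module_colon M (power_smult R M I (n + m)) (ideal_pow R I m)"

text \<open>For \<open>n \<ge> 1\<close> this is the Ratliff-Rush closure of \<open>I\<^sup>n\<close>, but the exponent \<open>m\<close> runs through all
  naturals and not only through the multiples of \<open>n\<close>. Then passing from \<open>n\<close> to \<open>n + 1\<close> shifts the exponents
  by one, and degree \<open>0\<close> gives the whole module.\<close>

definition rr_filtration ::
    "('a, 'r) ring_scheme \<Rightarrow> ('a, 'e, 'm) module_scheme \<Rightarrow> 'a set \<Rightarrow> nat \<Rightarrow> 'e set"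
  where "rr_filtration R M I n =
    (\<Union>m. rr_colon R M I n m)"

text \<open>With \<open>F\<close> the filtration above, this set is \<open>Ass (M / F\<^sub>n)\<close>, and \<open>ass_step\<close> below is
  \<open>Ass (F\<^sub>n / F\<^sub>n\<^sub>+\<^sub>1)\<close>.\<close>

definition ass_total ::
    "('a, 'r) ring_scheme \<Rightarrow> ('a, 'e, 'm) module_scheme \<Rightarrow> 'a set \<Rightarrow> nat \<Rightarrow> 'a set set"
  where "ass_total R M I n =
    {P. primeideal P R \<and> (\<exists>e\<in>carrier M. P = residual R M (rr_filtration R M I n) e)}"

definition ass_step ::
    "('a, 'r) ring_scheme \<Rightarrow> ('a, 'e, 'm) module_scheme \<Rightarrow> 'a set \<Rightarrow> nat \<Rightarrow> 'a set set"
  where "ass_step R M I n = {P. primeideal P R \<and>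
    (\<exists>e\<in>rr_filtration R M I n. P = residual R M (rr_filtration R M I (Suc n)) e)}"

context cring begin

lemma ideal_pow_0: "ideal_pow R I 0 = carrier R"
  by (simp add: ideals_set_def)

lemma ideal_pow_Suc: "ideal_pow R I (Suc n) = ideal_prod R (ideal_pow R I n) I"
  by (simp add: ideals_set_def)

lemma monoid_ideals_set: "monoid (ideals_set R)"
  using ideals_set_is_comm_monoid comm_monoid.axioms(1) by blast

lemma ideal_ideal_pow: "ideal I R \<Longrightarrow> ideal (ideal_pow R I n) R"
  using monoid.nat_pow_closed[OF monoid_ideals_set, of I n] by (simp add: ideals_set_def)

lemma ideal_pow_pow: "ideal I R \<Longrightarrow> ideal_pow R (ideal_pow R I m) n = ideal_pow R I (m * n)"
  using monoid.nat_pow_pow[OF monoid_ideals_set, of I m n] by (simp add: ideals_set_def)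

lemma ideal_pow_Suc_subset: "ideal I R \<Longrightarrow> ideal_pow R I (Suc n) \<subseteq> ideal_pow R I n"
  using ideal_prod_inter[OF ideal_ideal_pow[of I n], of I] unfolding ideal_pow_Suc by blast

lemma ideal_pow_SucI:
  assumes "ideal I R" "c \<in> ideal_pow R I n" "a \<in> I"
  shows "a \<otimes> c \<in> ideal_pow R I (Suc n)"
proof -
  have "a \<otimes> c = c \<otimes> a" using assms ideal.Icarr ideal_ideal_pow by (metis m_comm)
  then show ?thesis using assms unfolding ideal_pow_Suc by (simp add: ideal_prod.prod)
qed

end

context module begin

lemma submodule_smult_preimage:
  assumes N: "submodule N R M" and a: "a \<in> carrier R"
  shows "submodule {x \<in> carrier M. a \<odot>\<^bsub>M\<^esub> x \<in> N} R M"
proof (rule submoduleI, goal_cases)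
  case (5 b x)
  then have "a \<odot>\<^bsub>M\<^esub> (b \<odot>\<^bsub>M\<^esub> x) = b \<odot>\<^bsub>M\<^esub> (a \<odot>\<^bsub>M\<^esub> x)" using a by (metis (no_types, lifting) smult_assoc1 R.m_comm mem_Collect_eq)
  then show ?case using 5 submoduleE(4)[OF N] by simp
qed (use a submodule_zero_mem[OF N] submoduleE(3,5)[OF N] in \<open>auto simp: smult_r_minus smult_r_distr\<close>)

lemma submodule_module_colon:
  assumes N: "submodule N R M" and J: "J \<subseteq> carrier R"
  shows "submodule (module_colon M N J) R M"
proof (rule submoduleI, goal_cases)
  case 1 then show ?case unfolding module_colon_def by blast
next
  case 2 then show ?case using J submodule_zero_mem[OF N] unfolding module_colon_def by auto
next
  case (3 x)
  then show ?case
    using J submodule_smult_preimage[OF N, THEN submoduleE(3), of _ x] unfolding module_colon_def by blast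
next
  case (4 x y)
  then show ?case
    using J submodule_smult_preimage[OF N, THEN submoduleE(5), of _ x y] unfolding module_colon_def by blast
next
  case (5 r x)
  then show ?case
    using J submodule_smult_preimage[OF N, THEN submoduleE(4), of _ r x] unfolding module_colon_def by blast
qed

lemma module_colon_iff_residual:
  assumes "J \<subseteq> carrier R"
  shows "e \<in> module_colon M N J \<longleftrightarrow> e \<in> carrier M \<and> J \<subseteq> residual R M N e"
  using assms unfolding module_colon_def residual_def by blast

context
  fixes I assumes I: "ideal I R"
begin

lemma pow_carrier: "ideal_pow R I n \<subseteq> carrier R"
  using ideal.Icarr[OF R.ideal_ideal_pow[OF I]] by blast

lemma I_carrier: "I \<subseteq> carrier R"
  using ideal.Icarr[OF I] by blast

lemma submodule_power_smult: "submodule (power_smult R M I n) R M"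
  unfolding ideal_smult_def using pow_carrier by (intro submodule_span_submodule) auto

lemma power_smultI: "c \<in> ideal_pow R I n \<Longrightarrow> x \<in> carrier M \<Longrightarrow> c \<odot>\<^bsub>M\<^esub> x \<in> power_smult R M I n"
  unfolding ideal_smult_def by (rule subsetD[OF submodule_span_superset]) blast

lemma power_smult_least:
  assumes "submodule N R M" "\<And>c x. c \<in> ideal_pow R I n \<Longrightarrow> x \<in> carrier M \<Longrightarrow> c \<odot>\<^bsub>M\<^esub> x \<in> N"
  shows "power_smult R M I n \<subseteq> N"
  unfolding ideal_smult_def using assms by (intro submodule_span_minimal) auto

lemma power_smult_Suc_subset: "power_smult R M I (Suc n) \<subseteq> power_smult R M I n"
  using R.ideal_pow_Suc_subset[OF I, of n]
  by (intro power_smult_least[OF submodule_power_smult]) (auto intro: power_smultI)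

lemma power_smult_smult:
  assumes a: "a \<in> I" and x: "x \<in> power_smult R M I n"
  shows "a \<odot>\<^bsub>M\<^esub> x \<in> power_smult R M I (Suc n)"
proof -
  have aR: "a \<in> carrier R" using I_carrier a by blast
  have "power_smult R M I n \<subseteq> {x \<in> carrier M. a \<odot>\<^bsub>M\<^esub> x \<in> power_smult R M I (Suc n)}"
  proof (rule power_smult_least[OF submodule_smult_preimage[OF submodule_power_smult aR]])
    fix c x assume c: "c \<in> ideal_pow R I n" and x: "x \<in> carrier M"
    have cR: "c \<in> carrier R" using c pow_carrier by blast
    have "(a \<otimes> c) \<odot>\<^bsub>M\<^esub> x \<in> power_smult R M I (Suc n)"
      by (rule power_smultI[OF R.ideal_pow_SucI[OF I c a] x])
    then show "c \<odot>\<^bsub>M\<^esub> x \<in> {x \<in> carrier M. a \<odot>\<^bsub>M\<^esub> x \<in> power_smult R M I (Suc n)}"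
      using aR cR x by (simp add: smult_assoc1)
  qed
  then show ?thesis using x by blast
qed

text \<open>This places all \<open>I\<^sup>n M\<close> inside one graded module, which is Noetherian if \<open>M\<close> is.\<close>

lemma power_smult_rees:
  assumes as: "set as \<subseteq> carrier R" and gen: "I = Idl (set as)"
  shows "power_smult R M I n \<subseteq> rees M as n"
proof (induction n)
  case 0
  show ?case unfolding rees_0 by (rule submoduleE(1)[OF submodule_power_smult])
next
  case (Suc n)
  show ?case
  proof (rule power_smult_least[OF submodule_rees[OF as]])
    fix c x assume c: "c \<in> ideal_pow R I (Suc n)" and x: "x \<in> carrier M"
    have id: "ideal (residual R M (rees M as (Suc n)) y) R" if "y \<in> carrier M" for y
      by (rule ideal_residual[OF submodule_rees[OF as] that])
    have "ideal_pow R I (Suc n) \<subseteq> residual R M (rees M as (Suc n)) x"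
      unfolding R.ideal_pow_Suc
    proof (rule ideal_prod_least[OF id[OF x]])
      fix b d assume b: "b \<in> ideal_pow R I n" and d: "d \<in> I"
      have bR: "b \<in> carrier R" and dR: "d \<in> carrier R" using b d pow_carrier I_carrier by blast+
      have "b \<odot>\<^bsub>M\<^esub> x \<in> rees M as n" using Suc.IH power_smultI[OF b x] by blast
      then have "set as \<subseteq> residual R M (rees M as (Suc n)) (b \<odot>\<^bsub>M\<^esub> x)"
        using rees_smult[OF as] as unfolding residual_def by blast
      then have "I \<subseteq> residual R M (rees M as (Suc n)) (b \<odot>\<^bsub>M\<^esub> x)"
        unfolding gen using bR x by (intro R.genideal_minimal id) auto
      then have "d \<odot>\<^bsub>M\<^esub> (b \<odot>\<^bsub>M\<^esub> x) \<in> rees M as (Suc n)" using d unfolding residual_def by blast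
      then show "b \<otimes> d \<in> residual R M (rees M as (Suc n)) x"
        using bR dR x unfolding residual_def by (simp add: smult_assoc1[symmetric] R.m_comm)
    qed
    then show "c \<odot>\<^bsub>M\<^esub> x \<in> rees M as (Suc n)" using c unfolding residual_def by blast
  qed
qed

lemma rr_colon_Suc: "rr_colon R M I n m \<subseteq> rr_colon R M I n (Suc m)"
proof
  fix e assume e: "e \<in> rr_colon R M I n m"
  then have eM: "e \<in> carrier M" unfolding module_colon_def by blast
  have "ideal_pow R I (Suc m) \<subseteq> residual R M (power_smult R M I (n + Suc m)) e"
    unfolding R.ideal_pow_Suc
  proof (rule ideal_prod_least[OF ideal_residual[OF submodule_power_smult eM]])
    fix c a assume c: "c \<in> ideal_pow R I m" and a: "a \<in> I"
    have cR: "c \<in> carrier R" and aR: "a \<in> carrier R" using c a pow_carrier I_carrier by blast+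
    have "c \<odot>\<^bsub>M\<^esub> e \<in> power_smult R M I (n + m)" using e c unfolding module_colon_def by blast
    then have "a \<odot>\<^bsub>M\<^esub> (c \<odot>\<^bsub>M\<^esub> e) \<in> power_smult R M I (n + Suc m)" using power_smult_smult[OF a] by simp
    then show "c \<otimes> a \<in> residual R M (power_smult R M I (n + Suc m)) e"
      using cR aR eM unfolding residual_def by (simp add: smult_assoc1[symmetric] R.m_comm)
  qed
  then show "e \<in> rr_colon R M I n (Suc m)" using module_colon_iff_residual[OF pow_carrier] eM by blast
qed

lemma rr_colon_mono: "m \<le> m' \<Longrightarrow> rr_colon R M I n m \<subseteq> rr_colon R M I n m'"
  using lift_Suc_mono_le[of "rr_colon R M I n"] rr_colon_Suc by blast

lemma rr_filtration_carrier: "rr_filtration R M I n \<subseteq> carrier M"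
  unfolding rr_filtration_def module_colon_def by blast

lemma submodule_rr_colon: "submodule (rr_colon R M I n m) R M"
  by (rule submodule_module_colon[OF submodule_power_smult pow_carrier])

lemma submodule_rr_filtration: "submodule (rr_filtration R M I n) R M"
proof (rule submoduleI, goal_cases)
  case 1 show ?case by (rule rr_filtration_carrier)
next
  case 2 show ?case using submodule_zero_mem[OF submodule_rr_colon] unfolding rr_filtration_def by blast
next
  case (3 x) then show ?case using submoduleE(3)[OF submodule_rr_colon] unfolding rr_filtration_def by blast
next
  case (4 x y)
  then obtain k l where "x \<in> rr_colon R M I n k" "y \<in> rr_colon R M I n l" unfolding rr_filtration_def by blast
  then have "x \<in> rr_colon R M I n (max k l)" "y \<in> rr_colon R M I n (max k l)"
    using rr_colon_mono[of k "max k l" n] rr_colon_mono[of l "max k l" n] by auto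
  then show ?case using submoduleE(5)[OF submodule_rr_colon] unfolding rr_filtration_def by blast
next
  case (5 a x) then show ?case using submoduleE(4)[OF submodule_rr_colon] unfolding rr_filtration_def by blast
qed

text \<open>The stages \<open>(I\<^sup>n\<^sup>+\<^sup>m M : I\<^sup>m)\<close> increase with \<open>m\<close>, so the multiples of \<open>n\<close>, which are cofinal for
  \<open>n \<ge> 1\<close>, give the same union.\<close>

lemma rr_power_eq_rr_filtration:
  assumes "n \<ge> 1"
  shows "rr_power R M I n = rr_filtration R M I n"
proof -
  have "rr_power R M I n = (\<Union>k. rr_colon R M I n (n * k))"
    unfolding ratliff_rush_def R.ideal_pow_pow[OF I] by (simp only: distrib_left mult_1_right add.commute)
  moreover have "rr_colon R M I n m \<subseteq> rr_colon R M I n (n * m)" for m using rr_colon_mono assms by simp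
  ultimately show ?thesis unfolding rr_filtration_def by blast
qed

lemma rr_filtration_0: "rr_filtration R M I 0 = carrier M"
proof -
  have "e \<in> rr_colon R M I 0 0" if "e \<in> carrier M" for e
    using power_smultI[of _ 0] that unfolding module_colon_def by simp
  then show ?thesis using rr_filtration_carrier unfolding rr_filtration_def by blast
qed

lemma rr_filtration_Suc_subset: "rr_filtration R M I (Suc n) \<subseteq> rr_filtration R M I n"
  using power_smult_Suc_subset unfolding rr_filtration_def module_colon_def by fastforce

lemma rr_filtration_antimono: "n \<le> n' \<Longrightarrow> rr_filtration R M I n' \<subseteq> rr_filtration R M I n"
  using lift_Suc_antimono_le[of "rr_filtration R M I"] rr_filtration_Suc_subset by blast

lemma rr_filtration_smult:
  assumes a: "a \<in> I" and e: "e \<in> rr_filtration R M I n"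
  shows "a \<odot>\<^bsub>M\<^esub> e \<in> rr_filtration R M I (Suc n)"
proof -
  obtain m where m: "e \<in> rr_colon R M I n m" using e unfolding rr_filtration_def by blast
  have eM: "e \<in> carrier M" and aR: "a \<in> carrier R" using e a rr_filtration_carrier I_carrier by blast+
  have "c \<odot>\<^bsub>M\<^esub> (a \<odot>\<^bsub>M\<^esub> e) \<in> power_smult R M I (Suc n + m)" if c: "c \<in> ideal_pow R I m" for c
  proof -
    have "c \<in> carrier R" using c pow_carrier by blast
    then have "c \<odot>\<^bsub>M\<^esub> (a \<odot>\<^bsub>M\<^esub> e) = a \<odot>\<^bsub>M\<^esub> (c \<odot>\<^bsub>M\<^esub> e)" using aR eM by (metis smult_assoc1 R.m_comm)
    then show ?thesis using power_smult_smult[OF a, of _ "n + m"] m c unfolding module_colon_def by simp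
  qed
  then have "a \<odot>\<^bsub>M\<^esub> e \<in> rr_colon R M I (Suc n) m" using aR eM unfolding module_colon_def by simp
  then show ?thesis unfolding rr_filtration_def by blast
qed

lemma rr_filtration_pow_smult:
  "c \<in> ideal_pow R I m \<Longrightarrow> e \<in> rr_filtration R M I n \<Longrightarrow> c \<odot>\<^bsub>M\<^esub> e \<in> rr_filtration R M I (n + m)"
proof (induction m arbitrary: c)
  case 0
  then show ?case using submoduleE(4)[OF submodule_rr_filtration] R.ideal_pow_0 by simp
next
  case (Suc m)
  have eM: "e \<in> carrier M" using Suc.prems(2) rr_filtration_carrier by blast
  have "ideal_pow R I (Suc m) \<subseteq> residual R M (rr_filtration R M I (n + Suc m)) e"
    unfolding R.ideal_pow_Suc
  proof (rule ideal_prod_least[OF ideal_residual[OF submodule_rr_filtration eM]])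
    fix c a assume c: "c \<in> ideal_pow R I m" and a: "a \<in> I"
    have cR: "c \<in> carrier R" and aR: "a \<in> carrier R" using c a pow_carrier I_carrier by blast+
    have "a \<odot>\<^bsub>M\<^esub> (c \<odot>\<^bsub>M\<^esub> e) \<in> rr_filtration R M I (n + Suc m)"
      using rr_filtration_smult[OF a Suc.IH[OF c Suc.prems(2)]] by simp
    then show "c \<otimes> a \<in> residual R M (rr_filtration R M I (n + Suc m)) e"
      using cR aR eM unfolding residual_def by (simp add: smult_assoc1[symmetric] R.m_comm)
  qed
  then show ?case using Suc.prems(1) unfolding residual_def by blast
qed

context
  fixes S assumes S: "finite S" "S \<subseteq> carrier R" and gen: "I = Idl S"
begin

lemma S_subset_I: "S \<subseteq> I"
  unfolding gen by (rule R.genideal_self[OF S(2)])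

text \<open>The decisive property \<open>(F\<^sub>n\<^sub>+\<^sub>1 : I) \<subseteq> F\<^sub>n\<close>, which the powers \<open>I\<^sup>n M\<close> lack in general: since \<open>I\<close> is
  finitely generated, one exponent \<open>m\<close> works for all generators, and then \<open>I\<^sup>m\<^sup>+\<^sup>1 e \<subseteq> I\<^sup>n\<^sup>+\<^sup>1\<^sup>+\<^sup>m M\<close>.\<close>

lemma rr_filtration_colon:
  assumes e: "e \<in> carrier M" and Se: "\<And>a. a \<in> S \<Longrightarrow> a \<odot>\<^bsub>M\<^esub> e \<in> rr_filtration R M I (Suc n)"
  shows "e \<in> rr_filtration R M I n"
proof -
  have "\<forall>a\<in>S. \<exists>m. a \<odot>\<^bsub>M\<^esub> e \<in> rr_colon R M I (Suc n) m" using Se unfolding rr_filtration_def by blast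
  then obtain g where g: "\<And>a. a \<in> S \<Longrightarrow> a \<odot>\<^bsub>M\<^esub> e \<in> rr_colon R M I (Suc n) (g a)" by metis
  obtain m where m: "\<And>a. a \<in> S \<Longrightarrow> g a \<le> m"
    using finite_nat_set_iff_bounded_le[of "g ` S"] S(1) by auto
  have Sm: "a \<odot>\<^bsub>M\<^esub> e \<in> rr_colon R M I (Suc n) m" if "a \<in> S" for a
    using g[OF that] rr_colon_mono[OF m[OF that]] by blast
  let ?T = "power_smult R M I (n + Suc m)"
  have "ideal_pow R I (Suc m) \<subseteq> residual R M ?T e"
    unfolding R.ideal_pow_Suc
  proof (rule ideal_prod_least[OF ideal_residual[OF submodule_power_smult e]])
    fix c d assume c: "c \<in> ideal_pow R I m" and d: "d \<in> I"
    have cR: "c \<in> carrier R" and dR: "d \<in> carrier R" using c d pow_carrier I_carrier by blast+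
    have "S \<subseteq> residual R M ?T (c \<odot>\<^bsub>M\<^esub> e)"
    proof
      fix a assume a: "a \<in> S"
      have aR: "a \<in> carrier R" using a S by blast
      have "c \<odot>\<^bsub>M\<^esub> (a \<odot>\<^bsub>M\<^esub> e) \<in> ?T" using Sm[OF a] c unfolding module_colon_def by simp
      moreover have "c \<odot>\<^bsub>M\<^esub> (a \<odot>\<^bsub>M\<^esub> e) = a \<odot>\<^bsub>M\<^esub> (c \<odot>\<^bsub>M\<^esub> e)" using aR cR e by (metis smult_assoc1 R.m_comm)
      ultimately show "a \<in> residual R M ?T (c \<odot>\<^bsub>M\<^esub> e)" using aR unfolding residual_def by simp
    qed
    then have "Idl S \<subseteq> residual R M ?T (c \<odot>\<^bsub>M\<^esub> e)"
      using cR e by (intro R.genideal_minimal ideal_residual[OF submodule_power_smult]) auto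
    then have "d \<in> residual R M ?T (c \<odot>\<^bsub>M\<^esub> e)" by (rule subsetD) (rule d[unfolded gen])
    then show "c \<otimes> d \<in> residual R M ?T e"
      using cR dR e unfolding residual_def by (auto simp: smult_assoc1[symmetric] R.m_comm)
  qed
  then have "e \<in> rr_colon R M I n (Suc m)" using module_colon_iff_residual[OF pow_carrier] e by blast
  then show ?thesis unfolding rr_filtration_def by blast
qed

text \<open>For \<open>m = 1\<close>: \<open>F\<^sub>n = (F\<^sub>n\<^sub>+\<^sub>1 : I)\<close> gives \<open>P = \<Inter>a\<in>S. (F\<^sub>n\<^sub>+\<^sub>1 : a e)\<close>, and a prime that is a
  finite intersection of ideals is one of them. Larger \<open>m\<close> follow by iteration.\<close>

lemma associated_prime_shift:
  assumes P: "primeideal P R" and e: "e \<in> carrier M" and Pe: "P = residual R M (rr_filtration R M I n) e"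
  shows "\<exists>c\<in>ideal_pow R I m. P = residual R M (rr_filtration R M I (n + m)) (c \<odot>\<^bsub>M\<^esub> e)"
proof (induction m)
  case 0
  show ?case using Pe e R.ideal_pow_0 by (intro bexI[of _ \<one>]) auto
next
  case (Suc m)
  then obtain c where c: "c \<in> ideal_pow R I m" "P = residual R M (rr_filtration R M I (n + m)) (c \<odot>\<^bsub>M\<^esub> e)"
    by blast
  let ?N = "rr_filtration R M I (n + Suc m)" and ?y = "c \<odot>\<^bsub>M\<^esub> e"
  have cR: "c \<in> carrier R" using c pow_carrier by blast
  then have y: "?y \<in> carrier M" using e by simp
  have aR: "a \<in> carrier R" if "a \<in> S" for a using S that by blast
  have swap: "a \<odot>\<^bsub>M\<^esub> (r \<odot>\<^bsub>M\<^esub> ?y) = r \<odot>\<^bsub>M\<^esub> (a \<odot>\<^bsub>M\<^esub> ?y)" if "a \<in> S" "r \<in> carrier R" for a r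
    using that aR y by (metis smult_assoc1 R.m_comm)
  have "\<exists>a\<in>S. residual R M ?N (a \<odot>\<^bsub>M\<^esub> ?y) \<subseteq> P"
  proof (rule ccontr)
    assume neg: "\<not> ?thesis"
    obtain r where r: "r \<in> carrier R" "r \<notin> P" "\<And>a. a \<in> S \<Longrightarrow> r \<in> residual R M ?N (a \<odot>\<^bsub>M\<^esub> ?y)"
      by (rule R.prime_avoids_finite_intersection[OF P S(1), of "\<lambda>a. residual R M ?N (a \<odot>\<^bsub>M\<^esub> ?y)"])
        (use neg ideal_residual[OF submodule_rr_filtration] aR y in auto)
    have "r \<odot>\<^bsub>M\<^esub> ?y \<in> rr_filtration R M I (n + m)"
    proof (rule rr_filtration_colon)
      show "r \<odot>\<^bsub>M\<^esub> ?y \<in> carrier M" using r(1) y by simp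
      show "a \<odot>\<^bsub>M\<^esub> (r \<odot>\<^bsub>M\<^esub> ?y) \<in> rr_filtration R M I (Suc (n + m))" if "a \<in> S" for a
        using r(3)[OF that] swap[OF that r(1)] unfolding residual_def by simp
    qed
    then have "r \<in> P" using r(1) unfolding c(2) residual_def by simp
    then show False using r(2) by simp
  qed
  then obtain a where a: "a \<in> S" "residual R M ?N (a \<odot>\<^bsub>M\<^esub> ?y) \<subseteq> P" by blast
  have "P \<subseteq> residual R M ?N (a \<odot>\<^bsub>M\<^esub> ?y)"
  proof
    fix r assume "r \<in> P"
    then have r: "r \<in> carrier R" "r \<odot>\<^bsub>M\<^esub> ?y \<in> rr_filtration R M I (n + m)"
      unfolding c(2) residual_def by auto
    have "a \<odot>\<^bsub>M\<^esub> (r \<odot>\<^bsub>M\<^esub> ?y) \<in> ?N" using rr_filtration_smult[OF _ r(2), of a] a(1) S_subset_I by auto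
    then show "r \<in> residual R M ?N (a \<odot>\<^bsub>M\<^esub> ?y)" using r swap[OF a(1) r(1)] unfolding residual_def by simp
  qed
  then have "P = residual R M ?N (a \<odot>\<^bsub>M\<^esub> ?y)" using a(2) by (rule subset_antisym)
  then have "P = residual R M ?N ((a \<otimes> c) \<odot>\<^bsub>M\<^esub> e)" using aR[OF a(1)] cR e by (simp only: smult_assoc1)
  moreover have "a \<otimes> c \<in> ideal_pow R I (Suc m)"
    using R.ideal_pow_SucI[OF I c(1)] a(1) S_subset_I by blast
  ultimately show ?case by blast
qed

end

text \<open>Let \<open>k\<close> be the last index for which some multiple \<open>r e\<close> with \<open>r \<notin> P\<close> lies in \<open>F\<^sub>k\<close>. Then \<open>r e\<close>
  shows that \<open>P\<close> is associated to \<open>F\<^sub>k / F\<^sub>k\<^sub>+\<^sub>1\<close>.\<close>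

lemma ass_total_subset_steps: "ass_total R M I n \<subseteq> (\<Union>k. ass_step R M I k)"
proof
  let ?F = "rr_filtration R M I"
  fix P assume "P \<in> ass_total R M I n"
  then obtain e where P: "primeideal P R" and e: "e \<in> carrier M" "P = residual R M (?F n) e"
    unfolding ass_total_def by blast
  interpret P: primeideal P R by (rule P)
  define meets where "meets k \<longleftrightarrow> (\<exists>r\<in>carrier R. r \<notin> P \<and> r \<odot>\<^bsub>M\<^esub> e \<in> ?F k)" for k
  have "meets 0"
    unfolding meets_def using e P.one_imp_carrier P.I_notcarr rr_filtration_0
    by (intro bexI[of _ \<one>]) auto
  moreover have "\<not> meets n" unfolding meets_def e(2) residual_def by blast
  ultimately obtain k where k: "meets k" "\<not> meets (Suc k)" "Suc k \<le> n"
    using ex_least_nat_less[of "\<lambda>k. \<not> meets k" n] by auto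
  then obtain r where r: "r \<in> carrier R" "r \<notin> P" "r \<odot>\<^bsub>M\<^esub> e \<in> ?F k" unfolding meets_def by blast
  have "P = residual R M (?F (Suc k)) (r \<odot>\<^bsub>M\<^esub> e)"
  proof
    have "P = residual R M (?F n) (r \<odot>\<^bsub>M\<^esub> e)"
      by (rule prime_residual_multiple[OF P e(2) submodule_rr_filtration e(1) r(1,2)])
    then show "P \<subseteq> residual R M (?F (Suc k)) (r \<odot>\<^bsub>M\<^esub> e)"
      using rr_filtration_antimono[OF k(3)] unfolding residual_def by blast
    show "residual R M (?F (Suc k)) (r \<odot>\<^bsub>M\<^esub> e) \<subseteq> P"
    proof
      fix s assume "s \<in> residual R M (?F (Suc k)) (r \<odot>\<^bsub>M\<^esub> e)"
      then have s: "s \<in> carrier R" "(s \<otimes> r) \<odot>\<^bsub>M\<^esub> e \<in> ?F (Suc k)"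
        using r(1) e(1) unfolding residual_def by (auto simp: smult_assoc1)
      then have "s \<otimes> r \<in> P" using k(2) r(1) unfolding meets_def by blast
      then show "s \<in> P" using P.I_prime[OF s(1) r(1)] r(2) by blast
    qed
  qed
  then show "P \<in> (\<Union>k. ass_step R M I k)" using P r(3) unfolding ass_step_def by blast
qed

context
  assumes noeth: "noetherian_ring R" and fg: "finitely_generated_module R M"
begin

lemma ideal_generators: obtains as where "set as \<subseteq> carrier R" "I = Idl (set as)"
  using noetherian_ring.finetely_gen[OF noeth I] finite_list by metis

lemma ass_total_mono: "ass_total R M I n \<subseteq> ass_total R M I (n + m)"
proof
  fix P assume "P \<in> ass_total R M I n"
  then obtain e where P: "primeideal P R" and e: "e \<in> carrier M"
      "P = residual R M (rr_filtration R M I n) e" unfolding ass_total_def by blast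
  obtain as where as: "set as \<subseteq> carrier R" "I = Idl (set as)" by (rule ideal_generators)
  obtain c where c: "c \<in> ideal_pow R I m" "P = residual R M (rr_filtration R M I (n + m)) (c \<odot>\<^bsub>M\<^esub> e)"
    using associated_prime_shift[OF finite_set as P e] by blast
  then show "P \<in> ass_total R M I (n + m)" using P e pow_carrier unfolding ass_total_def by blast
qed

lemma ass_step_shift:
  assumes "P \<in> ass_step R M I n"
  shows "\<exists>e\<in>rr_filtration R M I n. \<forall>m. \<exists>c\<in>ideal_pow R I m.
    P = residual R M (rr_filtration R M I (Suc (n + m))) (c \<odot>\<^bsub>M\<^esub> e)"
proof -
  obtain e where P: "primeideal P R" and e: "e \<in> rr_filtration R M I n"
      "P = residual R M (rr_filtration R M I (Suc n)) e" using assms unfolding ass_step_def by blast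
  have eM: "e \<in> carrier M" using e rr_filtration_carrier by blast
  obtain as where as: "set as \<subseteq> carrier R" "I = Idl (set as)" by (rule ideal_generators)
  show ?thesis using associated_prime_shift[OF finite_set as P eM e(2)] e(1) by auto
qed

lemma ass_step_mono: "ass_step R M I n \<subseteq> ass_step R M I (n + m)"
proof
  fix P assume P: "P \<in> ass_step R M I n"
  then obtain e c where e: "e \<in> rr_filtration R M I n" and c: "c \<in> ideal_pow R I m"
      "P = residual R M (rr_filtration R M I (Suc (n + m))) (c \<odot>\<^bsub>M\<^esub> e)"
    using ass_step_shift by meson
  have "c \<odot>\<^bsub>M\<^esub> e \<in> rr_filtration R M I (n + m)" by (rule rr_filtration_pow_smult[OF c(1) e])
  then show "P \<in> ass_step R M I (n + m)" using P c(2) unfolding ass_step_def by blast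
qed

text \<open>An element \<open>e\<close> of \<open>F\<^sub>k\<close> satisfies \<open>I\<^sup>m e \<subseteq> I\<^sup>k\<^sup>+\<^sup>m M\<close> for some \<open>m\<close>, so shifting by \<open>m\<close> moves the
  witness of an associated prime from \<open>F\<^sub>k\<close> into \<open>I\<^sup>k\<^sup>+\<^sup>m M\<close>. All these primes therefore are associated to
  the single graded module with components \<open>I\<^sup>n M / (I\<^sup>n M \<inter> F\<^sub>n\<^sub>+\<^sub>1)\<close>, a quotient of the Noetherian Rees
  module.\<close>

lemma finite_ass_steps: "finite (\<Union>k. ass_step R M I k)"
proof -
  let ?F = "rr_filtration R M I"
  obtain as where as: "set as \<subseteq> carrier R" "I = Idl (set as)" by (rule ideal_generators)
  let ?G = "rees M as"
  define K where "K n = ?F (Suc n) \<inter> ?G n" for n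
  obtain X where X: "finite X" "X \<subseteq> carrier M" "submodule_span R M X = carrier M"
    using fg unfolding finitely_generated_module_def by blast
  note accR = noetherian_ring.acc_ideals[OF noeth]
  have "acc_on {N. submodule N R M}"
    using acc_submodules_of_span[OF accR X(1,2)] X(3) submoduleE(1)
    by (auto elim!: acc_on_subset)
  then have acc: "acc_on (graded_submodules R M (set as) ?G)"
    by (rule acc_graded_submodules_rees[OF _ as(1)])
  have G: "?G \<in> graded_submodules R M (set as) ?G"
    using submodule_rees[OF as(1)] rees_smult[OF as(1)] unfolding graded_submodules_def by blast
  have "submodule (K n) R M" for n
    using submodule_rr_filtration submodule_rees[OF as(1)] unfolding K_def
    by (intro submoduleI) (auto simp: submoduleE submodule_zero_mem dest: submoduleE(1) rees_carrier[OF as(1)])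
  moreover have "b \<odot>\<^bsub>M\<^esub> x \<in> K (Suc n)" if "b \<in> set as" "x \<in> K n" for b x n
    using that rr_filtration_smult[of b x "Suc n"] rees_smult[OF as(1), of b x n] S_subset_I[OF finite_set as]
    unfolding K_def by blast
  ultimately have K: "K \<in> graded_submodules R M (set as) ?G"
    unfolding graded_submodules_def K_def by blast
  have "P \<in> {P. primeideal P R \<and> (\<exists>n. \<exists>y\<in>?G n. P = residual R M (K n) y)}" if P: "P \<in> ass_step R M I k" for P k
  proof -
    obtain e where e: "e \<in> ?F k"
        "\<And>m. \<exists>c\<in>ideal_pow R I m. P = residual R M (?F (Suc (k + m))) (c \<odot>\<^bsub>M\<^esub> e)"
      using ass_step_shift[OF P] by blast
    obtain m where m: "e \<in> rr_colon R M I k m" using e(1) unfolding rr_filtration_def by blast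
    obtain c where c: "c \<in> ideal_pow R I m" "P = residual R M (?F (Suc (k + m))) (c \<odot>\<^bsub>M\<^esub> e)"
      using e(2) by blast
    have "c \<odot>\<^bsub>M\<^esub> e \<in> power_smult R M I (k + m)" using m c(1) unfolding module_colon_def by blast
    then have y: "c \<odot>\<^bsub>M\<^esub> e \<in> ?G (k + m)" using power_smult_rees[OF as] by blast
    have "P = residual R M (K (k + m)) (c \<odot>\<^bsub>M\<^esub> e)"
      unfolding c(2) K_def residual_def using submoduleE(4)[OF submodule_rees[OF as(1)] _ y] by blast
    then show ?thesis using y P unfolding ass_step_def by blast
  qed
  then have "(\<Union>k. ass_step R M I k) \<subseteq> {P. primeideal P R \<and> (\<exists>n. \<exists>y\<in>?G n. P = residual R M (K n) y)}" by blast
  then show ?thesis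
    by (rule finite_subset) (rule finite_graded_associated_primes[OF accR acc as(1) G K])
qed

end
end
end

section \<open>Increasing and eventually constant\<close>

lemma increasing_eventually_constant:
  fixes f :: "nat \<Rightarrow> 'x set"
  assumes mono: "\<And>n m. f n \<subseteq> f (n + m)" and sub: "\<And>n. f n \<subseteq> F" and fin: "finite F"
    and g: "\<And>n. n \<ge> 1 \<Longrightarrow> g n = f n"
  shows "mono_on {1..} g \<and> (\<exists>S. \<exists>N\<ge>1. \<forall>n\<ge>N. g n = S)"
proof
  have le: "f i \<subseteq> f j" if "i \<le> j" for i j using mono[of i "j - i"] that by simp
  then show "mono_on {1..} g" by (auto simp: mono_on_def g)
  have "card (f n) \<le> card F" for n using sub fin by (rule card_mono[rotated])
  then obtain N where N: "\<And>n. card (f n) \<le> card (f N)"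
    using ex_has_greatest_nat[of "\<lambda>_. True" 0 "\<lambda>n. card (f n)" "Suc (card F)"]
    by (auto simp: less_Suc_eq_le)
  have fN: "f n = f N" if "n \<ge> N" for n
    using card_seteq[OF finite_subset[OF sub fin] le[OF that] N[of n]] by simp
  have "g n = f N" if "n \<ge> Suc N" for n using g[of n] fN[of n] that by simp
  then show "\<exists>S. \<exists>N\<ge>1. \<forall>n\<ge>N. g n = S" by (intro exI[of _ "f N"] exI[of _ "Suc N"]) simp
qed

theorem theorem1p2:
  fixes R :: "('a, 'r) ring_scheme" and E :: "('a, 'e, 'm) module_scheme" and I :: "'a set"
  assumes "cring R" and "noetherian_ring R" and "\<one>\<^bsub>R\<^esub> \<noteq> \<zero>\<^bsub>R\<^esub>"
    and "ideal I R"
    and "module R E" and "finitely_generated_module R E" and "carrier E \<noteq> {\<zero>\<^bsub>E\<^esub>}"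
  shows "(mono_on {1..} (\<lambda>n. Ass R (quotient_module E (rr_power R E I n)))
      \<and> (\<exists>S. \<exists>N\<ge>1. \<forall>n\<ge>N. Ass R (quotient_module E (rr_power R E I n)) = S))
    \<and> (mono_on {1..} (\<lambda>n. Ass R (quotient_module (E\<lparr>carrier := rr_power R E I n\<rparr>) (rr_power R E I (n + 1))))
      \<and> (\<exists>S. \<exists>N\<ge>1. \<forall>n\<ge>N. Ass R (quotient_module (E\<lparr>carrier := rr_power R E I n\<rparr>) (rr_power R E I (n + 1))) = S))"
proof -
  interpret E: module R E by fact
  note I = \<open>ideal I R\<close> and hyps = \<open>ideal I R\<close> \<open>noetherian_ring R\<close> \<open>finitely_generated_module R E\<close>
  note sub = E.submodule_rr_filtration[OF I]
  have rr: "rr_power R E I n = rr_filtration R E I n" if "n \<ge> 1" for n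
    by (rule E.rr_power_eq_rr_filtration[OF I that])
  have total: "Ass R (quotient_module E (rr_power R E I n)) = ass_total R E I n" if "n \<ge> 1" for n
    unfolding rr[OF that] ass_total_def by (rule E.Ass_quotient_module[OF sub])
  have step: "Ass R (quotient_module (E\<lparr>carrier := rr_power R E I n\<rparr>) (rr_power R E I (n + 1)))
      = ass_step R E I n" if "n \<ge> 1" for n
    using E.Ass_subquotient_module[OF sub sub E.rr_filtration_Suc_subset[OF I, of n]] rr[of n] rr[of "n + 1"] that
    unfolding ass_step_def by simp
  show ?thesis
  proof (rule conjI)
    show "mono_on {1..} (\<lambda>n. Ass R (quotient_module E (rr_power R E I n)))
      \<and> (\<exists>S. \<exists>N\<ge>1. \<forall>n\<ge>N. Ass R (quotient_module E (rr_power R E I n)) = S)"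
      by (rule increasing_eventually_constant[OF E.ass_total_mono[OF hyps]
            E.ass_total_subset_steps[OF I] E.finite_ass_steps[OF hyps] total])
    show "mono_on {1..} (\<lambda>n. Ass R (quotient_module (E\<lparr>carrier := rr_power R E I n\<rparr>) (rr_power R E I (n + 1))))
      \<and> (\<exists>S. \<exists>N\<ge>1. \<forall>n\<ge>N. Ass R (quotient_module (E\<lparr>carrier := rr_power R E I n\<rparr>) (rr_power R E I (n + 1))) = S)"
      by (rule increasing_eventually_constant[OF E.ass_step_mono[OF hyps] _ E.finite_ass_steps[OF hyps] step]) blast
  qed
qed

end
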